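(* Let $\Omega\subset\mathbb{R}^d$ be a bounded domain such that $\mathbb{R}^d\setminus\partial\Omega$ has exactly two connected components, let $y\in C(\bar\Omega;\mathbb{R}^d)$ be approximately invertible on the boundary ($y\in\operatorname{AIB}$), and let $$\operatorname{im}_T(y;\Omega):=\{z\in\mathbb{R}^d\setminus y(\partial\Omega) : \operatorname{deg}(y;\Omega;z)\neq 0\}.$$ Then there exists a fixed $\sigma\in\{\pm1\}$ such that $$\operatorname{deg}(y;\Omega;z)=\sigma\quad\text{for every } z\in\operatorname{im}_T(y;\Omega).$$ Moreover, $\operatorname{im}_T(y;\Omega)$ is an open subset of $\mathcal{B}(\mathbb{R}^d\setminus y(\partial\Omega))$, and any connected component of $\mathcal{B}(\mathbb{R}^d\setminus y(\partial\Omega))$ is either fully contained in $\operatorname{im}_T(y;\Omega)$ or does not intersect $\operatorname{im}_T(y;\Omega)$ at all.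
   Context: Throughout $d\in\mathbb{N}$, $d\ge 2$. A domain is an open connected set. $\operatorname{deg}(y;A;z)\in\mathbb{Z}$ denotes the topological (Brouwer) degree of a continuous map $y:\bar A\to\mathbb{R}^d$ on a bounded open set $A\subset\mathbb{R}^d$ with respect to $z\in\mathbb{R}^d\setminus y(\partial A)$. A map $y:\bar\Omega\to\mathbb{R}^d$, continuous on $\partial\Omega$, is approximately invertible on the boundary, $y\in\operatorname{AIB}$, if there is a sequence of injective maps $\varphi_k\in C(\partial\Omega;\mathbb{R}^d)$ with $\varphi_k\to y$ uniformly on $\partial\Omega$. For compact $K\subset\mathbb{R}^d$, $\mathcal{B}(\mathbb{R}^d\setminus K)$ denotes the union of all bounded connected components of $\mathbb{R}^d\setminus K$. *)

theory Defs
  imports "HOL-Analysis.Analysis"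
begin

section \<open>Brouwer degree on bounded open subsets of Euclidean space\<close>

definition C1_map_on :: "(real^'n) set \<Rightarrow> (real^'n \<Rightarrow> real^'n) \<Rightarrow> bool" where
  "C1_map_on A g \<longleftrightarrow>
     (\<forall>x\<in>A. g differentiable (at x)) \<and> continuous_on A (\<lambda>x. jacobian g (at x))"

definition regular_value_on :: "(real^'n) set \<Rightarrow> (real^'n \<Rightarrow> real^'n) \<Rightarrow> real^'n \<Rightarrow> bool" where
  "regular_value_on A g z \<longleftrightarrow> (\<forall>x\<in>A. g x = z \<longrightarrow> det (jacobian g (at x)) \<noteq> 0)"

text \<open>The degree of a \<open>C\<^sup>1\<close> map at a regular value \<open>z \<notin> g ` frontier A\<close>; for bounded
  open \<open>A\<close> the index set of the sum is then finite.\<close>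

definition regular_degree :: "(real^'n \<Rightarrow> real^'n) \<Rightarrow> (real^'n) set \<Rightarrow> real^'n \<Rightarrow> real" where
  "regular_degree g A z = (\<Sum>x | x \<in> A \<and> g x = z. sgn (det (jacobian g (at x))))"

text \<open>The maps through which the degree of a merely continuous \<open>y\<close> at \<open>z\<close> is computed.
  For compact \<open>closure A\<close> the pointwise estimate amounts to
  \<open>sup {\<bar>g x - y x\<bar> | x \<in> closure A} < dist(z, y ` frontier A)\<close>; in particular
  \<open>z \<notin> g ` frontier A\<close>.\<close>

definition degree_approximant ::
  "(real^'n \<Rightarrow> real^'n) \<Rightarrow> (real^'n) set \<Rightarrow> real^'n \<Rightarrow> (real^'n \<Rightarrow> real^'n) \<Rightarrow> bool" where
  "degree_approximant y A z g \<longleftrightarrow>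
     continuous_on (closure A) g \<and> C1_map_on A g \<and> regular_value_on A g z \<and>
     (\<forall>x\<in>closure A. dist (g x) (y x) < infdist z (y ` frontier A))"

text \<open>The Brouwer degree \<open>deg(y; A; z)\<close>, meaningful for \<open>A\<close> bounded and open, \<open>y\<close> continuous on
  \<open>closure A\<close> and \<open>z \<notin> y ` frontier A\<close>: the common value of \<open>regular_degree g A z\<close> for all
  approximants \<open>g\<close>.\<close>

definition brouwer_deg :: "(real^'n \<Rightarrow> real^'n) \<Rightarrow> (real^'n) set \<Rightarrow> real^'n \<Rightarrow> int" where
  "brouwer_deg y A z =
     (THE n. \<exists>g. degree_approximant y A z g \<and> real_of_int n = regular_degree g A z)"


section \<open>Topological image and approximate invertibility on the boundary\<close>

definition im_T :: "(real^'n \<Rightarrow> real^'n) \<Rightarrow> (real^'n) set \<Rightarrow> (real^'n) set" where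
  "im_T y \<Omega> = {z. z \<notin> y ` frontier \<Omega> \<and> brouwer_deg y \<Omega> z \<noteq> 0}"

definition AIB :: "(real^'n) set \<Rightarrow> (real^'n \<Rightarrow> real^'n) \<Rightarrow> bool" where
  "AIB \<Omega> y \<longleftrightarrow>
     continuous_on (frontier \<Omega>) y \<and>
     (\<exists>\<phi> :: nat \<Rightarrow> real^'n \<Rightarrow> real^'n.
        (\<forall>k. continuous_on (frontier \<Omega>) (\<phi> k) \<and> inj_on (\<phi> k) (frontier \<Omega>)) \<and>
        uniform_limit (frontier \<Omega>) \<phi> y sequentially)"

definition bounded_part :: "(real^'n) set \<Rightarrow> (real^'n) set" where
  "bounded_part U = \<Union> {C \<in> components U. bounded C}"

lemma bounded_part_Compl_eq_inside: "bounded_part (- K) = inside K"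
  unfolding bounded_part_def inside_def components_def
  by (auto dest: connected_component_in
      simp: connected_component_eq intro: connected_component_refl)

end

theory Submission
  imports Defs
begin

text \<open>
  Two \<open>C\<^sup>1\<close> maps that agree off a compact subset of an open set have the same integral of
  the Jacobian determinant: for \<open>u\<close> and \<open>w\<close> agreeing outside a ball and small \<open>s\<close>, the maps
  \<open>x + s u(x)\<close> and \<open>x + s w(x)\<close> are injective on a larger ball and have the same image, so the
  integrals of \<open>det (I + s Du)\<close> and \<open>det (I + s Dw)\<close> agree; both are polynomials in \<open>s\<close>, and one
  compares the top coefficients. Composing with a map that is constant in each coordinate away from
  \<open>z\<close> localizes these integrals near the preimages of \<open>z\<close>, where the change of variables formula
  turns them into the regular degree. This gives homotopy invariance, and with Sard's theorem and
  polynomial approximation the usual properties of the Brouwer degree.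

  Let \<open>f\<close> be injective on \<open>\<partial>\<Omega>\<close>, let \<open>\<psi>\<close> extend its inverse \<open>f(\<partial>\<Omega>) \<rightarrow> \<partial>\<Omega>\<close>, let \<open>deg(f; \<Omega>; q) \<noteq> 0\<close> and
  let \<open>\<Delta>\<close> be the component of \<open>q\<close> in the complement of \<open>f(\<partial>\<Omega>)\<close>. Since \<open>f \<circ> \<psi>\<close> is the identity
  on \<open>\<partial>\<Delta>\<close>, and since \<open>\<Omega>\<close> is the only bounded component of the complement of \<open>\<partial>\<Omega>\<close>, the product
  formula gives \<open>deg(\<psi>; \<Delta>; \<Omega>) deg(f; \<Omega>; u) = deg(id; \<Delta>; u)\<close>, which is 1 for \<open>u\<close> in \<open>\<Delta>\<close> and 0
  elsewhere. Hence the nonzero values of \<open>deg(f; \<Omega>; \<cdot>)\<close> are all equal to one and the same unit.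
  For \<open>y\<close> itself compare any two points with an injective boundary map uniformly close to \<open>y\<close>.
\<close>

subsection \<open>Continuously differentiable maps\<close>

text \<open>The derivative is carried as an explicit matrix field \<open>J\<close>. The rules below
  then deliver the Jacobian of a sum, product or composition as a formula, whereas
  \<open>C1_map_on\<close> speaks only of the chosen \<open>jacobian\<close>.\<close>

definition C1_with :: "(real^'n) set \<Rightarrow> (real^'n \<Rightarrow> real^'n) \<Rightarrow> (real^'n \<Rightarrow> real^'n^'n) \<Rightarrow> bool" where
  "C1_with A g J \<longleftrightarrow> (\<forall>x\<in>A. (g has_derivative (\<lambda>h. J x *v h)) (at x)) \<and> continuous_on A J"

lemma jacobian_eqI:
  assumes "(g has_derivative (\<lambda>h. J *v h)) (at x)"
  shows "jacobian g (at x) = J"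
  unfolding jacobian_def frechet_derivative_at[OF assms, symmetric]
  by (simp add: matrix_def matrix_vector_mult_def axis_def vec_eq_iff if_distrib cong: if_cong)

lemma C1_with_jacobian: "C1_with A g J \<Longrightarrow> x \<in> A \<Longrightarrow> jacobian g (at x) = J x"
  by (simp add: C1_with_def jacobian_eqI)

lemma C1_map_on_with: "C1_map_on A g \<longleftrightarrow> C1_with A g (\<lambda>x. jacobian g (at x))"
  unfolding C1_map_on_def C1_with_def by (simp add: jacobian_works)

lemma C1_with_imp:
  assumes "C1_with A g J"
  shows "C1_map_on A g"
proof -
  have "continuous_on A (\<lambda>x. jacobian g (at x)) = continuous_on A J"
    by (rule continuous_on_cong) (auto simp: C1_with_jacobian[OF assms])
  then show ?thesis
    using assms unfolding C1_map_on_def C1_with_def by (auto intro: differentiableI)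
qed

lemma C1_with_continuous_on: "C1_with A g J \<Longrightarrow> continuous_on A g"
  unfolding C1_with_def
  by (auto intro!: continuous_at_imp_continuous_on has_derivative_continuous)

lemma C1_with_subset: "C1_with A g J \<Longrightarrow> B \<subseteq> A \<Longrightarrow> C1_with B g J"
  unfolding C1_with_def by (auto intro: continuous_on_subset)

lemma C1_with_open_cong:
  assumes "C1_with A g J" "open A" "\<And>x. x \<in> A \<Longrightarrow> g x = h x"
  shows "C1_with A h J"
proof -
  have "(h has_derivative (\<lambda>v. J x *v v)) (at x)" if "x \<in> A" for x
    using assms that
    by (intro has_derivative_transform_within_open[of g _ x UNIV A h]) (auto simp: C1_with_def)
  then show ?thesis using assms(1) by (simp add: C1_with_def)
qed

lemma C1_with_Un:
  assumes "C1_with A g J" "open A" "C1_with B g J" "open B"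
  shows "C1_with (A \<union> B) g J"
  using assms unfolding C1_with_def by (auto intro: continuous_on_open_Un)

lemma continuous_on_matrix_entries:
  fixes J :: "'a::topological_space \<Rightarrow> real^'n^'m"
  assumes "\<And>i j. continuous_on A (\<lambda>x. J x $ i $ j)"
  shows "continuous_on A J"
proof -
  have "continuous_on A (\<lambda>x. \<chi> i. \<chi> j. J x $ i $ j)"
    by (intro continuous_on_vec_lambda assms)
  then show ?thesis by simp
qed

lemma C1_with_const: "C1_with A (\<lambda>x. c) (\<lambda>x. 0)"
  unfolding C1_with_def by (simp add: matrix_vector_mult_0[abs_def])

lemma C1_with_id: "C1_with (A :: (real^'n) set) (\<lambda>x. x) (\<lambda>x. mat 1)"
proof -
  have "(\<lambda>h::real^'n. mat 1 *v h) = (\<lambda>h. h)" by (rule ext) (rule matrix_vector_mul_lid)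
  then show ?thesis unfolding C1_with_def by (simp only: has_derivative_ident continuous_on_const simp_thms ball_triv)
qed

lemma C1_with_add:
  "C1_with A g J \<Longrightarrow> C1_with A h K \<Longrightarrow> C1_with A (\<lambda>x. g x + h x) (\<lambda>x. J x + K x)"
  unfolding C1_with_def
  by (auto intro!: continuous_on_add has_derivative_eq_rhs[OF has_derivative_add]
      simp: matrix_vector_mult_add_rdistrib)

lemma C1_with_diff:
  "C1_with A g J \<Longrightarrow> C1_with A h K \<Longrightarrow> C1_with A (\<lambda>x. g x - h x) (\<lambda>x. J x - K x)"
  unfolding C1_with_def
  by (auto intro!: continuous_on_diff has_derivative_eq_rhs[OF has_derivative_diff]
      simp: matrix_vector_mult_diff_rdistrib)

lemma continuous_on_matrix_mult:
  fixes J K :: "'a::topological_space \<Rightarrow> real^'n^'n"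
  assumes "continuous_on A J" "continuous_on A K"
  shows "continuous_on A (\<lambda>x. J x ** K x)"
  unfolding matrix_matrix_mult_def
  by (intro continuous_on_matrix_entries) (auto intro!: continuous_intros assms)

lemma C1_with_compose:
  assumes "C1_with A g J" "C1_with B h K" "g ` A \<subseteq> B"
  shows "C1_with A (\<lambda>x. h (g x)) (\<lambda>x. K (g x) ** J x)"
  unfolding C1_with_def
proof safe
  fix x assume x: "x \<in> A"
  have "(g has_derivative (\<lambda>h. J x *v h)) (at x)" "(h has_derivative (\<lambda>v. K (g x) *v v)) (at (g x))"
    using assms x unfolding C1_with_def by auto
  from diff_chain_at[OF this] 
  show "((\<lambda>x. h (g x)) has_derivative (\<lambda>v. (K (g x) ** J x) *v v)) (at x)"
    by (simp add: o_def matrix_vector_mul_assoc)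
next
  have "continuous_on A g" by (rule C1_with_continuous_on[OF assms(1)])
  moreover have "continuous_on (g ` A) K"
    using assms by (auto simp: C1_with_def intro: continuous_on_subset)
  ultimately have "continuous_on A (\<lambda>x. K (g x))"
    using continuous_on_compose[of A g K] by (simp add: o_def)
  then show "continuous_on A (\<lambda>x. K (g x) ** J x)"
    using assms(1) by (auto simp: C1_with_def intro: continuous_on_matrix_mult)
qed

text \<open>Product rule with a scalar factor: the second summand is the outer product of
  \<open>g x\<close> with the gradient \<open>D x\<close> of \<open>c\<close>.\<close>

lemma C1_with_scale:
  fixes g :: "real^'n \<Rightarrow> real^'n"
  assumes "\<And>x. x \<in> A \<Longrightarrow> (c has_derivative (\<lambda>h. D x \<bullet> h)) (at x)" "continuous_on A D"
    and "C1_with A g J"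
  shows "C1_with A (\<lambda>x. c x *\<^sub>R g x) (\<lambda>x. c x *\<^sub>R J x + (\<chi> i j. g x $ i * D x $ j))"
  unfolding C1_with_def
proof safe
  fix x assume x: "x \<in> A"
  have "(g has_derivative (\<lambda>h. J x *v h)) (at x)" using assms x unfolding C1_with_def by auto
  from has_derivative_scaleR[OF assms(1)[OF x] this]
  show "((\<lambda>x. c x *\<^sub>R g x) has_derivative (\<lambda>v. (c x *\<^sub>R J x + (\<chi> i j. g x $ i * D x $ j)) *v v)) (at x)"
  proof (rule has_derivative_eq_rhs, intro ext)
    fix v :: "real^'n"
    have "(\<Sum>j\<in>UNIV. (c x * J x $ i $ j + g x $ i * D x $ j) * v $ j) =
        c x * (\<Sum>j\<in>UNIV. J x $ i $ j * v $ j) + (\<Sum>j\<in>UNIV. D x $ j * v $ j) * g x $ i" for i :: 'n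
      by (simp add: sum_distrib_left sum_distrib_right sum.distrib[symmetric] algebra_simps)
    then show "c x *\<^sub>R (J x *v v) + (D x \<bullet> v) *\<^sub>R g x =
      (c x *\<^sub>R J x + (\<chi> i j. g x $ i * D x $ j)) *v v"
      by (simp add: vec_eq_iff matrix_vector_mult_def inner_vec_def)
  qed
next
  have "continuous_on A c" by (intro continuous_at_imp_continuous_on ballI has_derivative_continuous[OF assms(1)])
  moreover have "continuous_on A g" by (rule C1_with_continuous_on[OF assms(3)])
  moreover have "continuous_on A J" using assms(3) by (auto simp: C1_with_def)
  ultimately show "continuous_on A (\<lambda>x. c x *\<^sub>R J x + (\<chi> i j. g x $ i * D x $ j))"
    using assms(2) by (intro continuous_on_add continuous_on_scaleR continuous_on_matrix_entries) (auto intro!: continuous_intros)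
qed

section \<open>Differentiability of polynomial maps\<close>

lemma real_polynomial_function_C1:
  fixes p :: "real^'n \<Rightarrow> real"
  assumes "real_polynomial_function p"
  shows "\<exists>D. continuous_on UNIV D \<and> (\<forall>x. (p has_derivative (\<lambda>h. D x \<bullet> h)) (at x))"
  using assms
proof (induction)
  case (linear f)
  \<comment> \<open>Riesz representation: the constant gradient of a linear functional is its
    adjoint applied to 1.\<close>
  have "f = (\<lambda>h. adjoint f 1 \<bullet> h)"
    using adjoint_works[OF bounded_linear.linear[OF linear], of _ 1] by (simp add: fun_eq_iff inner_commute)
  then obtain a where "f = (\<lambda>h. a \<bullet> h)" by blast
  then show ?case
    by (auto intro!: exI[of _ "\<lambda>x. a"] bounded_linear_imp_has_derivative bounded_linear_inner_right)
next
  case (const c)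
  then show ?case by (intro exI[of _ "\<lambda>x. 0"]) auto
next
  case (add f g)
  then obtain D E where "continuous_on UNIV D" "continuous_on UNIV E"
    "\<forall>x. (f has_derivative (\<lambda>h. D x \<bullet> h)) (at x)" "\<forall>x. (g has_derivative (\<lambda>h. E x \<bullet> h)) (at x)" by blast
  then show ?case
    by (intro exI[of _ "\<lambda>x. D x + E x"])
      (auto intro!: continuous_intros has_derivative_eq_rhs[OF has_derivative_add] simp: inner_add_left)
next
  case (mult f g)
  then obtain D E where *: "continuous_on UNIV D" "continuous_on UNIV E"
    "\<forall>x. (f has_derivative (\<lambda>h. D x \<bullet> h)) (at x)" "\<forall>x. (g has_derivative (\<lambda>h. E x \<bullet> h)) (at x)" by blast
  have "continuous_on UNIV f" "continuous_on UNIV g"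
    using * by (auto intro!: continuous_at_imp_continuous_on has_derivative_continuous)
  with * show ?case
    by (intro exI[of _ "\<lambda>x. g x *\<^sub>R D x + f x *\<^sub>R E x"])
      (auto intro!: continuous_intros has_derivative_eq_rhs[OF has_derivative_mult] simp: inner_add_left)
qed

lemma polynomial_function_C1:
  fixes p :: "real^'n \<Rightarrow> real^'n"
  assumes "polynomial_function p"
  shows "\<exists>J. C1_with UNIV p J"
proof -
  have "\<forall>i. real_polynomial_function (\<lambda>x. p x $ i)"
  proof
    fix i
    have "real_polynomial_function ((\<lambda>x. x $ i) \<circ> p)"
      using assms bounded_linear_vec_nth unfolding polynomial_function_def by blast
    then show "real_polynomial_function (\<lambda>x. p x $ i)"
      by (simp add: o_def)
  qed
  then have "\<forall>i. \<exists>D. continuous_on UNIV D \<and> (\<forall>x. ((\<lambda>x. p x $ i) has_derivative (\<lambda>h. D x \<bullet> h)) (at x))"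
    using real_polynomial_function_C1 by blast
  then obtain D where D: "\<And>i. continuous_on UNIV (D i)" "\<And>i x. ((\<lambda>x. p x $ i) has_derivative (\<lambda>h. D i x \<bullet> h)) (at x)"
    by metis
  have "C1_with UNIV p (\<lambda>x. (\<chi> i. D i x))"
    unfolding C1_with_def
  proof safe
    fix x 
    show "(p has_derivative (\<lambda>h. (\<chi> i. D i x) *v h)) (at x)"
    proof (subst has_derivative_componentwise_within, safe)
      fix b :: "real^'n" assume "b \<in> Basis"
      then obtain i where "b = axis i 1" by (auto simp: Basis_vec_def)
      then show "((\<lambda>x. p x \<bullet> b) has_derivative (\<lambda>x'. ((\<chi> i. D i x) *v x') \<bullet> b)) (at x)"
        using D(2)[of i x] by (simp add: inner_axis matrix_vector_mul_component[of "\<chi> i. D i x" _ i])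
    qed
  next
    show "continuous_on UNIV (\<lambda>x. (\<chi> i. D i x))"
      using D(1) by (auto intro: continuous_on_vec_lambda)
  qed
  then show ?thesis by blast
qed

section \<open>Cutoff functions of class C1\<close>

definition tent :: "real \<Rightarrow> real \<Rightarrow> real" where
  "tent e t = max 0 (e - \<bar>t\<bar>)"

text \<open>For \<open>e \<ge> 0\<close> this is the odd antiderivative of \<open>tent e\<close>,
  constant on each side of the interval from \<open>-e\<close> to \<open>e\<close>. Building it from
  \<open>t * \<bar>t\<bar>\<close>, which has derivative \<open>2 * \<bar>t\<bar>\<close>
  everywhere, avoids a piecewise definition.\<close>

definition ramp :: "real \<Rightarrow> real \<Rightarrow> real" where
  "ramp e t = ((t + e) * \<bar>t + e\<bar> + (t - e) * \<bar>t - e\<bar> - 2 * (t * \<bar>t\<bar>)) / 4"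

lemma has_real_derivative_mult_abs: "((\<lambda>t::real. t * \<bar>t\<bar>) has_real_derivative 2 * \<bar>t\<bar>) (at t)"
proof -
  consider "t > 0" | "t < 0" | "t = 0" by linarith
  then show ?thesis
  proof cases
    case 1
    have "((\<lambda>t::real. t * t) has_real_derivative 2 * t) (at t)"
      by (auto intro!: derivative_eq_intros)
    then have "((\<lambda>t::real. t * \<bar>t\<bar>) has_real_derivative 2 * t) (at t)"
      by (rule has_field_derivative_transform_within_open[of _ _ _ "{0<..}"]) (use 1 in auto)
    then show ?thesis using 1 by simp
  next
    case 2
    have "((\<lambda>t::real. - (t * t)) has_real_derivative - 2 * t) (at t)"
      by (auto intro!: derivative_eq_intros)
    then have "((\<lambda>t::real. t * \<bar>t\<bar>) has_real_derivative - 2 * t) (at t)"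
      by (rule has_field_derivative_transform_within_open[of _ _ _ "{..<0}"]) (use 2 in auto)
    then show ?thesis using 2 by simp
  next
    case 3
    \<comment> \<open>At the origin the difference quotient of \<open>t * \<bar>t\<bar>\<close> is
      \<open>\<bar>h\<bar>\<close>.\<close>
    have "((\<lambda>h::real. \<bar>h\<bar>) \<longlongrightarrow> 0) (at 0)"
      by (auto intro: tendsto_eq_intros)
    moreover have "\<forall>\<^sub>F h in at 0. \<bar>h\<bar> = (h * \<bar>h\<bar>) / (h::real)"
      by (auto simp: eventually_at_filter)
    ultimately have "((\<lambda>h::real. (h * \<bar>h\<bar>) / h) \<longlongrightarrow> 0) (at 0)"
      by (rule Lim_transform_eventually)
    then show ?thesis using 3 by (simp add: DERIV_def)
  qed
qed

lemma ramp_deriv: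
  assumes "e \<ge> 0"
  shows "(ramp e has_real_derivative tent e t) (at t)"
proof -
  have 1: "((\<lambda>t. (t + a) * \<bar>t + a\<bar>) has_real_derivative 2 * \<bar>t + a\<bar>) (at t)" for a :: real
    using DERIV_shift[of "\<lambda>t. t * \<bar>t\<bar>" "2 * \<bar>t + a\<bar>" t a] has_real_derivative_mult_abs[of "t + a"]
    by simp
  have "(ramp e has_real_derivative (2 * \<bar>t + e\<bar> + 2 * \<bar>t + (- e)\<bar> - 2 * (2 * \<bar>t + 0\<bar>)) / 4) (at t)"
    using DERIV_cdivide[OF DERIV_diff[OF DERIV_add[OF 1[of e] 1[of "- e"]] DERIV_cmult[OF 1[of 0], of 2]], of 4]
    by (simp add: ramp_def[abs_def])
  moreover have "(2 * \<bar>t + e\<bar> + 2 * \<bar>t + (- e)\<bar> - 2 * (2 * \<bar>t + 0\<bar>)) / 4 = tent e t"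
    using assms unfolding tent_def by (auto simp: abs_if max_def)
  ultimately show ?thesis by simp
qed

lemma continuous_on_tent: "continuous_on A f \<Longrightarrow> continuous_on A (\<lambda>x. tent e (f x))"
  unfolding tent_def by (intro continuous_intros)

lemma tent_nonneg: "0 \<le> tent e t"
  by (simp add: tent_def)

lemma tent_pos: "0 < e \<Longrightarrow> 0 < tent e 0"
  by (simp add: tent_def)

lemma tent_eq_0: "e \<le> \<bar>t\<bar> \<Longrightarrow> tent e t = 0"
  by (simp add: tent_def)

text \<open>The distance to \<open>K\<close>, divided by a margin \<open>e\<close>, is approximated
  by a polynomial \<open>p\<close> on a large ball, and a C1 step function made from
  \<open>ramp\<close> is applied to \<open>p\<close>. The step is 1 where \<open>p\<close> is below
  1/4 and 0 where \<open>p\<close> is above 3/4.\<close>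

lemma C1_cutoff:
  fixes K A :: "(real^'n) set"
  assumes "compact K" "open A" "K \<subseteq> A"
  obtains c D V L where "\<And>x. (c has_derivative (\<lambda>h. D x \<bullet> h)) (at x)" "continuous_on UNIV D"
    "\<And>x. 0 \<le> c x \<and> c x \<le> (1::real)"
    "open V" "K \<subseteq> V" "\<And>x. x \<in> V \<Longrightarrow> c x = 1" "compact L" "L \<subseteq> A" "\<And>x. x \<notin> L \<Longrightarrow> c x = 0"
proof (cases "K = {}")
  case True
  show ?thesis
    by (rule that[of "\<lambda>x. 0" "\<lambda>x. 0" "{}" "{}"]) (use True in auto)
next
  case False
  obtain e where e: "e > 0" "(\<Union>x\<in>K. ball x e) \<subseteq> A"
    using compact_subset_open_imp_ball_epsilon_subset[OF assms] by blast
  have near: "\<exists>k\<in>K. dist x k < r" if "infdist x K < r" for x r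
  proof -
    obtain k where "k \<in> K" "infdist x K = dist x k"
      using infdist_attains_inf[OF compact_imp_closed[OF assms(1)] False] by blast
    with that show ?thesis by auto
  qed
  \<comment> \<open>The scaled distance is below 1/8 on \<open>V\<close> and above 7/8 off
    \<open>L\<close>. An approximation error of 1/8 still leaves \<open>p\<close> below 1/4 on
    \<open>V\<close>, and above 3/4 on the part of the ball outside \<open>L\<close>.\<close>
  define L where "L = {x. infdist x K \<le> 7 * e / 8}"
  define V where "V = {x. infdist x K < e / 8}"
  have "bounded K" using assms(1) compact_imp_bounded by blast
  then obtain R0 where R0: "\<And>k. k \<in> K \<Longrightarrow> norm k \<le> R0" by (auto simp: bounded_iff)
  have LR: "L \<subseteq> ball 0 (R0 + e)"
  proof
    fix x assume "x \<in> L"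
    then have "infdist x K < e" using e(1) by (auto simp: L_def)
    then obtain k where "k \<in> K" "dist x k < e" using near by blast
    then show "x \<in> ball 0 (R0 + e)" using R0[of k] norm_triangle_ineq[of k "x - k"] by (auto simp: dist_norm)
  qed
  have Lcl: "closed L" unfolding L_def by (intro closed_Collect_le continuous_intros continuous_on_infdist)
  have L: "compact L" using LR Lcl bounded_ball bounded_subset compact_eq_bounded_closed by blast
  have LA: "L \<subseteq> A"
  proof
    fix x assume "x \<in> L"
    then have "infdist x K < e" using e(1) by (auto simp: L_def)
    then obtain k where "k \<in> K" "dist x k < e" using near by blast
    then have "x \<in> ball k e" by (simp add: dist_commute)
    then show "x \<in> A" using e(2) \<open>k \<in> K\<close> by blast
  qed
  have Vo: "open V" unfolding V_def by (intro open_Collect_less continuous_intros continuous_on_infdist)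
  have KV: "K \<subseteq> V" using e(1) by (auto simp: V_def)
  have VL: "V \<subseteq> L" using e(1) by (auto simp: V_def L_def)
  let ?B = "ball (0::real^'n) (R0 + e)"
  have "continuous_on (cball 0 (R0 + e)) (\<lambda>x. infdist x K / e)"
    using e(1) by (intro continuous_intros continuous_on_infdist) auto
  then obtain p where p: "real_polynomial_function p" "\<And>x. x \<in> cball 0 (R0 + e) \<Longrightarrow> \<bar>infdist x K / e - p x\<bar> < 1/8"
    using Stone_Weierstrass_real_polynomial_function[OF compact_cball, of 0 "R0 + e" "\<lambda>x. infdist x K / e" "1/8"] by auto
  obtain E where E: "continuous_on UNIV E" "\<And>x. (p has_derivative (\<lambda>h. E x \<bullet> h)) (at x)"
    using real_polynomial_function_C1[OF p(1)] by blast
  \<comment> \<open>The plateau values of \<open>ramp (1/4)\<close> are -1/32 and 1/32; the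
    constants 16 and 1/2 send them to 0 and 1.\<close>
  define st where "st = (\<lambda>x. 16 * ramp (1/4) (1/2 - p x) + 1/2)"
  have ramp_val: "ramp (1/4) t = 1/32" if "t \<ge> 1/4" for t
    using that by (simp add: ramp_def power2_eq_square algebra_simps)
  have ramp_val': "ramp (1/4) t = - 1/32" if "t \<le> - 1/4" for t
    using that by (simp add: ramp_def power2_eq_square algebra_simps)
  have mono: "ramp (1/4) s \<le> ramp (1/4) t" if "s \<le> t" for s t
    by (rule DERIV_nonneg_imp_nondecreasing[OF that]) (use ramp_deriv[of "1/4"] tent_nonneg in \<open>auto intro!: exI\<close>)
  have ramp_le: "ramp (1/4) t \<le> 1/32" for t
    using mono[of t "max t (1/4)"] ramp_val[of "max t (1/4)"] by simp
  have ramp_ge: "- 1/32 \<le> ramp (1/4) t" for t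
    using mono[of "min t (-1/4)" t] ramp_val'[of "min t (-1/4)"] by simp
  have st_deriv: "(st has_derivative (\<lambda>h. (- 16 * tent (1/4) (1/2 - p x)) *\<^sub>R E x \<bullet> h)) (at x)" for x
  proof -
    have "((\<lambda>x. 1/2 - p x) has_derivative (\<lambda>h. - (E x \<bullet> h))) (at x)"
      using E(2)[of x] by (auto intro!: derivative_eq_intros)
    moreover have "(ramp (1/4) has_derivative (\<lambda>h. tent (1/4) (1/2 - p x) * h)) (at (1/2 - p x))"
      using ramp_deriv[of "1/4" "1/2 - p x"] by (simp add: has_field_derivative_def)
    ultimately have "((\<lambda>x. ramp (1/4) (1/2 - p x)) has_derivative (\<lambda>h. tent (1/4) (1/2 - p x) * (- (E x \<bullet> h)))) (at x)"
      by (rule diff_chain_at[unfolded o_def])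
    then show ?thesis unfolding st_def
      by (auto intro!: derivative_eq_intros)
  qed
  have st0: "st x = 0 \<and> tent (1/4) (1/2 - p x) = 0" if "x \<in> ?B" "x \<notin> L" for x
  proof -
    have "7/8 < infdist x K / e" using that e(1) by (auto simp: L_def field_simps)
    moreover have "\<bar>infdist x K / e - p x\<bar> < 1/8" using p(2)[of x] that by simp
    ultimately have "p x > 3/4" by linarith
    then show ?thesis using ramp_val'[of "1/2 - p x"] by (auto simp: st_def tent_def)
  qed
  have st1: "st x = 1" if "x \<in> V" for x
  proof -
    have "infdist x K / e < 1/8" using that e(1) by (auto simp: V_def field_simps)
    moreover have "x \<in> ?B" using that VL LR by auto
    then have "\<bar>infdist x K / e - p x\<bar> < 1/8" using p(2)[of x] by simp
    ultimately have "p x < 1/4" by linarith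
    then show ?thesis using ramp_val[of "1/2 - p x"] by (auto simp: st_def)
  qed
  \<comment> \<open>Outside the ball \<open>p\<close> is not controlled, so the cutoff is set to 0
    there. The ball and the complement of \<open>L\<close> are open and cover the space, and on
    their overlap the step vanishes as well.\<close>
  define c where "c = (\<lambda>x. if x \<in> ?B then st x else 0)"
  define D where "D = (\<lambda>x. if x \<in> ?B then (- 16 * tent (1/4) (1/2 - p x)) *\<^sub>R E x else 0)"
  have c0: "c x = 0" "D x = 0" if "x \<notin> L" for x using st0[of x] that by (auto simp: c_def D_def)
  have cont1: "continuous_on ?B D"
  proof -
    have "continuous_on ?B p" using E(2) by (auto intro!: continuous_at_imp_continuous_on has_derivative_continuous)
    then have "continuous_on ?B (\<lambda>x. (- 16 * tent (1/4) (1/2 - p x)) *\<^sub>R E x)"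
      using E(1) by (intro continuous_intros continuous_on_tent) (auto intro: continuous_on_subset)
    then show ?thesis by (rule continuous_on_eq) (auto simp: D_def)
  qed
  have cont2: "continuous_on (- L) D"
    by (rule continuous_on_eq[of _ "\<lambda>x. 0"]) (auto simp: c0)
  have "?B \<union> - L = UNIV" using LR by auto
  then have "continuous_on UNIV D" using continuous_on_open_Un[OF _ _ cont1 cont2] Lcl by auto
  moreover have "(c has_derivative (\<lambda>h. D x \<bullet> h)) (at x)" for x
  proof (cases "x \<in> ?B")
    case True
    then show ?thesis using has_derivative_transform_within_open[OF st_deriv[of x], of ?B c] 
      by (auto simp: c_def D_def)
  next
    case False
    then have "x \<in> - L" using LR by auto
    then show ?thesis using has_derivative_transform_within_open[of "\<lambda>x. 0" "\<lambda>h. 0" x UNIV "- L" c] Lcl c0 by (auto)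
  qed
  moreover have "0 \<le> c x \<and> c x \<le> 1" for x
    using ramp_le[of "1/2 - p x"] ramp_ge[of "1/2 - p x"] by (auto simp: c_def st_def)
  moreover have "c x = 1" if "x \<in> V" for x using st1[OF that] that VL LR by (auto simp: c_def)
  ultimately show ?thesis using that[of c D V L] Vo KV L LA c0 by blast
qed

section \<open>Determinants and small perturbations of the identity\<close>

lemma continuous_on_det: 
  fixes J :: "'a::topological_space \<Rightarrow> real^'n^'n"
  assumes "continuous_on A J"
  shows "continuous_on A (\<lambda>x. det (J x))"
  unfolding det_def by (intro continuous_intros assms)

text \<open>In the Leibniz formula each product is expanded over the set \<open>X\<close> of rows
  whose factor comes from \<open>s *\<^sub>R M\<close>, and the terms are sorted by
  \<open>card X\<close>. For the top power only \<open>X = UNIV\<close> remains, which gives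
  \<open>det M\<close>.\<close>

lemma det_pencil_expansion:
  obtains c :: "nat \<Rightarrow> real^'n^'n \<Rightarrow> real" where "\<And>k. continuous_on UNIV (c k)"
    "\<And>M s. det (mat 1 + s *\<^sub>R M) = (\<Sum>k\<le>CARD('n). c k M * s ^ k)" "c CARD('n) = det"
proof -
  define c where "c = (\<lambda>k (M::real^'n^'n). \<Sum>p\<in>{p. p permutes (UNIV::'n set)}. of_int (sign p) *
    (\<Sum>X\<in>{X\<in>Pow UNIV. card X = k}. (\<Prod>i\<in>X. M $ i $ p i) * (\<Prod>i\<in>UNIV - X. mat 1 $ i $ p i)))"
  show ?thesis
  proof (rule that[of c])
    show "continuous_on UNIV (c k)" for k
      unfolding c_def by (intro continuous_intros)
    have "{X\<in>Pow UNIV. card X = CARD('n)} = {UNIV::'n set}" using card_subset_eq[OF finite_class.finite_UNIV] by auto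
    then show "c CARD('n) = det" unfolding c_def det_def by (intro ext) simp
    fix M :: "real^'n^'n" and s :: real
    have *: "(\<Prod>i\<in>UNIV. (mat 1 + s *\<^sub>R M) $ i $ p i) = (\<Sum>k\<le>CARD('n). 
       (\<Sum>X\<in>{X\<in>Pow UNIV. card X = k}. (\<Prod>i\<in>X. M $ i $ p i) * (\<Prod>i\<in>UNIV - X. mat 1 $ i $ p i)) * s ^ k)" (is "?l = ?r") for p :: "'n \<Rightarrow> 'n"
    proof -
      have "?l = (\<Prod>i\<in>UNIV. s * M $ i $ p i + mat 1 $ i $ p i)" by (simp add: add.commute)
      also have "\<dots> = (\<Sum>X\<in>Pow UNIV. (\<Prod>i\<in>X. s * M $ i $ p i) * (\<Prod>i\<in>UNIV - X. mat 1 $ i $ p i))"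
        by (rule prod_add) simp
      also have "\<dots> = (\<Sum>k\<le>CARD('n). \<Sum>X\<in>{X\<in>Pow UNIV. card X = k}. (\<Prod>i\<in>X. s * M $ i $ p i) * (\<Prod>i\<in>UNIV - X. mat 1 $ i $ p i))"
        by (rule sum.group[symmetric]) (auto intro: card_mono)
      also have "\<dots> = ?r"
        unfolding sum_distrib_right by (intro sum.cong refl) (simp add: prod.distrib mult_ac)
      finally show ?thesis .
    qed
    show "det (mat 1 + s *\<^sub>R M) = (\<Sum>k\<le>CARD('n). c k M * s ^ k)"
      unfolding det_def * c_def sum_distrib_left sum_distrib_right
      by (subst sum.swap) (simp add: mult_ac)
  qed
qed

lemma onorm_matrix_le: 
  fixes M :: "real^'n^'n"
  shows "onorm (\<lambda>h. M *v h) \<le> real CARD('n) * real CARD('n) * norm M"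
proof (rule onorm_le_matrix_component)
  fix i j :: 'n
  have "\<bar>M $ i $ j\<bar> \<le> norm (M $ i)" by (rule component_le_norm_cart)
  also have "\<dots> \<le> norm M" by (rule Finite_Cartesian_Product.norm_nth_le)
  finally show "\<bar>M $ i $ j\<bar> \<le> norm M" .
qed

text \<open>A bound \<open>C\<close> for the operator norms of \<open>J\<close> on the ball is also
  a Lipschitz constant of \<open>u\<close> there. For \<open>s * C < 1\<close> this makes
  \<open>x + s *\<^sub>R u x\<close> injective and the kernel of its derivative trivial.\<close>

lemma small_perturbation_of_id:
  fixes u :: "real^'n \<Rightarrow> real^'n"
  assumes "C1_with UNIV u J"
  obtains s0 where "s0 > 0" "\<And>s. 0 \<le> s \<Longrightarrow> s < s0 \<Longrightarrow> inj_on (\<lambda>x. x + s *\<^sub>R u x) (cball 0 R)"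
    "\<And>s x. 0 \<le> s \<Longrightarrow> s < s0 \<Longrightarrow> x \<in> cball 0 R \<Longrightarrow> det (mat 1 + s *\<^sub>R J x) > 0"
proof -
  have cJ: "continuous_on UNIV J" and dJ: "\<And>x. (u has_derivative (\<lambda>h. J x *v h)) (at x)"
    using assms by (auto simp: C1_with_def)
  have "bounded (J ` cball 0 R)"
    by (intro compact_imp_bounded compact_continuous_image compact_cball continuous_on_subset[OF cJ]) auto
  then obtain B where B: "B > 0" "\<And>x. x \<in> cball 0 R \<Longrightarrow> norm (J x) \<le> B"
    by (auto simp: bounded_pos)
  define C where "C = real CARD('n) * real CARD('n) * B"
  have "C > 0" using B(1) by (simp add: C_def)
  have on: "onorm (\<lambda>h. J x *v h) \<le> C" if "x \<in> cball 0 R" for x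
    unfolding C_def by (rule order_trans[OF onorm_matrix_le mult_left_mono[OF B(2)[OF that]]]) simp
  have lip: "norm (u x - u y) \<le> C * norm (x - y)" if "x \<in> cball 0 R" "y \<in> cball 0 R" for x y
    by (rule differentiable_bound[OF convex_cball _ on that]) (use dJ in \<open>auto intro: has_derivative_at_withinI\<close>)
  show ?thesis
  proof (rule that[of "1 / C"])
    show "1 / C > 0" using \<open>C > 0\<close> by simp
    fix s :: real assume s: "0 \<le> s" "s < 1 / C"
    have sC: "s * C < 1" using s \<open>C > 0\<close> by (simp add: field_simps)
    show "inj_on (\<lambda>x. x + s *\<^sub>R u x) (cball 0 R)"
    proof (rule inj_onI, rule ccontr)
      fix x y assume xy: "x \<in> cball 0 R" "y \<in> cball 0 R" "x + s *\<^sub>R u x = y + s *\<^sub>R u y" "x \<noteq> y"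
      then have "x - y = - (s *\<^sub>R (u x - u y))" by (simp add: algebra_simps)
      then have "norm (x - y) = norm (- (s *\<^sub>R (u x - u y)))" by (rule arg_cong)
      then have "norm (x - y) = s * norm (u x - u y)" using s(1) by simp
      also have "\<dots> \<le> s * (C * norm (x - y))" using lip[OF xy(1,2)] s(1) by (simp add: mult_left_mono)
      also have "\<dots> = (s * C) * norm (x - y)" by simp
      also have "\<dots> < 1 * norm (x - y)" using sC xy(4) by (intro mult_strict_right_mono) auto
      finally show False by simp
    qed
    fix x :: "real^'n" assume x: "x \<in> cball 0 R"
    have nz: "det (mat 1 + t *\<^sub>R J x) \<noteq> 0" if "0 \<le> t" "t \<le> s" for t
    proof -
      have tC: "t * C < 1" using sC that \<open>C > 0\<close> mult_right_mono[of t s C] by linarith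
      have "v = 0" if "(mat 1 + t *\<^sub>R J x) *v v = 0" for v
      proof (rule ccontr)
        assume "v \<noteq> 0"
        have "v = - (t *\<^sub>R (J x *v v))" 
          using that unfolding matrix_vector_mult_add_rdistrib scaleR_matrix_vector_assoc[symmetric] matrix_vector_mul_lid
          by (rule eq_neg_iff_add_eq_0[THEN iffD2])
        then have "norm v = norm (- (t *\<^sub>R (J x *v v)))" by (rule arg_cong)
        then have "norm v = t * norm (J x *v v)" using \<open>0 \<le> t\<close> by simp
        also have "\<dots> \<le> t * (C * norm v)"
        proof (rule mult_left_mono[OF _ \<open>0 \<le> t\<close>])
          have "norm (J x *v v) \<le> onorm (\<lambda>h. J x *v h) * norm v"
            by (rule onorm[OF matrix_vector_mul_bounded_linear])
          also have "\<dots> \<le> C * norm v" using on[OF x] by (rule mult_right_mono) simp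
          finally show "norm (J x *v v) \<le> C * norm v" .
        qed
        also have "\<dots> = (t * C) * norm v" by simp
        also have "\<dots> < 1 * norm v" using tC \<open>v \<noteq> 0\<close> by (intro mult_strict_right_mono) auto
        finally show False by simp
      qed
      then show ?thesis
        unfolding invertible_det_nz[symmetric] invertible_left_inverse matrix_left_invertible_ker by blast
    qed
    have cont: "continuous_on {0..s} (\<lambda>t. det (mat 1 + t *\<^sub>R J x))"
      by (intro continuous_on_det continuous_intros)
    show "det (mat 1 + s *\<^sub>R J x) > 0"
    proof (rule ccontr)
      assume "\<not> ?thesis"
      \<comment> \<open>The determinant is 1 at \<open>t = 0\<close>, so a value that is not
        positive at \<open>s\<close> would force a zero in between.\<close>
      then have "\<exists>t\<ge>0. t \<le> s \<and> det (mat 1 + t *\<^sub>R J x) = 0"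
        by (intro IVT2' cont s) auto
      then show False using nz by blast
    qed
  qed
qed

subsection \<open>The integral of the Jacobian determinant\<close>

lemma image_cball_subset:
  fixes F G :: "real^'n \<Rightarrow> real^'n"
  assumes F: "continuous_on (cball 0 R) F" "inj_on F (cball 0 R)"
    and G: "continuous_on (cball 0 R) G" "inj_on G (cball 0 R)"
    and eq: "\<And>x. x \<in> cball 0 R \<Longrightarrow> r < norm x \<Longrightarrow> F x = G x" and r: "0 \<le> r" "r < R"
  shows "F ` ball 0 R \<subseteq> G ` ball 0 R"
proof -
  have opG: "open (G ` ball 0 R)"
    by (rule invariance_of_domain) (use G in \<open>auto intro: continuous_on_subset inj_on_subset\<close>)
  have clG: "closed (G ` cball 0 R)"
    by (intro compact_imp_closed compact_continuous_image G compact_cball)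
  have con: "connected (F ` ball 0 R)"
    by (intro connected_continuous_image continuous_on_subset[OF F(1)] connected_ball) auto
  \<comment> \<open>Any point strictly between the radii \<open>r\<close> and \<open>R\<close> has
    the same image under both maps.\<close>
  obtain x :: "real^'n" where x: "norm x = (r + R) / 2"
    using vector_choose_size[of "(r + R) / 2"] r by auto
  have xb: "x \<in> ball 0 R" and "F x = G x" using x r eq[of x] by auto
  then have "F x \<in> F ` ball 0 R \<inter> G ` ball 0 R" by (metis IntI imageI)
  then have ne: "G ` ball 0 R \<inter> F ` ball 0 R \<noteq> {}" by auto
  have sph: "G x \<notin> F ` ball 0 R" if "norm x = R" for x
  proof
    assume "G x \<in> F ` ball 0 R"
    then obtain y where y: "norm y < R" "G x = F y" by auto
    have "F x = F y" using eq[of x] that r y by auto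
    then have "x = y" using F(2) that y by (auto dest: inj_onD)
    with that y show False by auto
  qed
  have "F ` ball 0 R \<subseteq> G ` ball 0 R \<union> - G ` cball 0 R"
    using sph by (force simp: image_iff)
  moreover have "G ` ball 0 R \<inter> - G ` cball 0 R = {}" by auto
  ultimately have "- G ` cball 0 R \<inter> F ` ball 0 R = {}"
    using connectedD[OF con opG open_Compl[OF clG]] ne by auto
  then show ?thesis using \<open>F ` ball 0 R \<subseteq> G ` ball 0 R \<union> - G ` cball 0 R\<close> by auto
qed

lemma image_cball_eq:
  fixes F G :: "real^'n \<Rightarrow> real^'n"
  assumes F: "continuous_on (cball 0 R) F" "inj_on F (cball 0 R)"
    and G: "continuous_on (cball 0 R) G" "inj_on G (cball 0 R)"
    and eq: "\<And>x. x \<in> cball 0 R \<Longrightarrow> r < norm x \<Longrightarrow> F x = G x" and r: "0 \<le> r" "r < R"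
  shows "F ` cball 0 R = G ` cball 0 R"
proof -
  have "F ` ball 0 R = G ` ball 0 R"
    using image_cball_subset[OF F G eq r] image_cball_subset[OF G F eq[symmetric] r] by blast
  moreover have "F ` sphere 0 R = G ` sphere 0 R"
    using eq r by (intro image_cong) auto
  moreover have "cball (0::real^'n) R = ball 0 R \<union> sphere 0 R" by auto
  ultimately show ?thesis by (simp only: image_Un)
qed

lemma integrable_on_compact:
  fixes f :: "'a::euclidean_space \<Rightarrow> real"
  assumes "compact S" "continuous_on S f"
  shows "f integrable_on S"
  using borel_integrable_compact[OF assms]
  by (intro set_borel_integral_eq_integral(1)) (simp add: set_integrable_def)

text \<open>For small \<open>s\<close> the volume of the image of the ball under
  \<open>x + s *\<^sub>R u x\<close> is a polynomial in \<open>s\<close> whose top coefficient is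
  the integral of \<open>det (J x)\<close>. The image under \<open>x + s *\<^sub>R w x\<close> is
  the same set, so the two polynomials coincide.\<close>

lemma integral_det_eq:
  fixes u w :: "real^'m::{finite,wellorder} \<Rightarrow> real^'m::_"
  assumes u: "C1_with UNIV u J" and w: "C1_with UNIV w K"
    and eq: "\<And>x. r < norm x \<Longrightarrow> u x = w x" and r: "0 \<le> r" "r < R"
  shows "integral (cball 0 R) (\<lambda>x. det (J x)) = integral (cball 0 R) (\<lambda>x. det (K x))"
proof -
  let ?B = "cball (0::real^'m::_) R"
  obtain c :: "nat \<Rightarrow> ((real, 'm::_) vec, 'm::_) vec \<Rightarrow> real" where c: "\<And>k. continuous_on UNIV (c k)"
    "\<And>M s. det (mat 1 + s *\<^sub>R M) = (\<Sum>k\<le>CARD('m). c k M * s ^ k)" "c CARD('m) = det"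
    by (rule det_pencil_expansion[where 'n='m]) (rule that; assumption)
  obtain s1 where s1: "s1 > 0" "\<And>s. 0 \<le> s \<Longrightarrow> s < s1 \<Longrightarrow> inj_on (\<lambda>x. x + s *\<^sub>R u x) ?B"
    "\<And>s x. 0 \<le> s \<Longrightarrow> s < s1 \<Longrightarrow> x \<in> ?B \<Longrightarrow> det (mat 1 + s *\<^sub>R J x) > 0"
    by (rule small_perturbation_of_id[OF u, of R]) (rule that; assumption)
  obtain s2 where s2: "s2 > 0" "\<And>s. 0 \<le> s \<Longrightarrow> s < s2 \<Longrightarrow> inj_on (\<lambda>x. x + s *\<^sub>R w x) ?B"
    "\<And>s x. 0 \<le> s \<Longrightarrow> s < s2 \<Longrightarrow> x \<in> ?B \<Longrightarrow> det (mat 1 + s *\<^sub>R K x) > 0"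
    by (rule small_perturbation_of_id[OF w, of R]) (rule that; assumption)
  have cont: "continuous_on ?B H \<Longrightarrow> continuous_on ?B (\<lambda>x. c k (H x))" for k H
    using continuous_on_compose2[OF c(1), of ?B H k] by auto
  have vol: "measure lebesgue ((\<lambda>x. x + s *\<^sub>R v x) ` ?B) = (\<Sum>k\<le>CARD('m). integral ?B (\<lambda>x. c k (H x)) * s ^ k)"
    if v: "C1_with UNIV v H" and inj: "inj_on (\<lambda>x. x + s *\<^sub>R v x) ?B"
      and pos: "\<And>x. x \<in> ?B \<Longrightarrow> det (mat 1 + s *\<^sub>R H x) > 0" for v H s
  proof -
    have cH: "continuous_on ?B H" using v by (auto simp: C1_with_def intro: continuous_on_subset)
    have cd: "continuous_on ?B (\<lambda>x. \<bar>det (mat 1 + s *\<^sub>R H x)\<bar>)"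
      by (intro continuous_intros continuous_on_det cH)
    have int: "(\<lambda>x. \<bar>det (matrix (\<lambda>h. (mat 1 + s *\<^sub>R H x) *v h))\<bar>) integrable_on ?B"
      unfolding matrix_of_matrix_vector_mul
      by (rule integrable_on_compact[OF compact_cball cd])
    have der: "((\<lambda>x. x + s *\<^sub>R v x) has_derivative (\<lambda>h. (mat 1 + s *\<^sub>R H x) *v h)) (at x within ?B)" for x
    proof -
      have "(v has_derivative (\<lambda>h. H x *v h)) (at x within ?B)"
        using v by (auto simp: C1_with_def intro: has_derivative_at_withinI)
      from has_derivative_add[OF has_derivative_ident has_derivative_scaleR_right[OF this, of s]]
      show ?thesis
        by (simp only: matrix_vector_mult_add_rdistrib scaleR_matrix_vector_assoc[symmetric] matrix_vector_mul_lid)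
    qed
    \<comment> \<open>Injectivity expresses the volume by the absolute value of the determinant;
      positivity then removes the absolute value and leaves a polynomial in
      \<open>s\<close>.\<close>
    have "measure lebesgue ((\<lambda>x. x + s *\<^sub>R v x) ` ?B) = integral ?B (\<lambda>x. \<bar>det (matrix (\<lambda>h. (mat 1 + s *\<^sub>R H x) *v h))\<bar>)"
      by (rule measure_differentiable_image_eq[OF _ der inj int]) simp
    also have "\<dots> = integral ?B (\<lambda>x. (\<Sum>k\<le>CARD('m). c k (H x) * s ^ k))"
      unfolding matrix_of_matrix_vector_mul
    proof (rule integral_cong)
      fix x assume "x \<in> ?B"
      then show "\<bar>det (mat 1 + s *\<^sub>R H x)\<bar> = (\<Sum>k\<le>CARD('m). c k (H x) * s ^ k)"
        using pos[of x] c(2)[of s "H x"] by linarith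
    qed
    also have "\<dots> = (\<Sum>k\<le>CARD('m). integral ?B (\<lambda>x. c k (H x) * s ^ k))"
      by (intro integral_sum integrable_on_compact[OF compact_cball] continuous_on_mult continuous_on_const cont cH) simp
    also have "\<dots> = (\<Sum>k\<le>CARD('m). integral ?B (\<lambda>x. c k (H x)) * s ^ k)"
      by simp
    finally show ?thesis .
  qed
  have same: "(\<lambda>x. x + s *\<^sub>R u x) ` ?B = (\<lambda>x. x + s *\<^sub>R w x) ` ?B" if "0 \<le> s" "s < s1" "s < s2" for s
  proof (rule image_cball_eq[of _ _ _ r, OF _ s1(2)[OF that(1,2)] _ s2(2)[OF that(1,3)] _ r])
    show "continuous_on ?B (\<lambda>x. x + s *\<^sub>R u x)" "continuous_on ?B (\<lambda>x. x + s *\<^sub>R w x)"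
      using C1_with_continuous_on[OF u] C1_with_continuous_on[OF w]
      by (auto intro!: continuous_on_add continuous_on_id continuous_on_scaleR continuous_on_const
          intro: continuous_on_subset)
    show "x + s *\<^sub>R u x = x + s *\<^sub>R w x" if "r < norm x" for x
      using eq[OF that] by simp
  qed
  let ?d = "\<lambda>k. integral ?B (\<lambda>x. c k (J x)) - integral ?B (\<lambda>x. c k (K x))"
  have "(\<Sum>k\<le>CARD('m). ?d k * s ^ k) = 0" if "0 \<le> s" "s < s1" "s < s2" for s
  proof -
    have "(\<Sum>k\<le>CARD('m). integral ?B (\<lambda>x. c k (J x)) * s ^ k) = (\<Sum>k\<le>CARD('m). integral ?B (\<lambda>x. c k (K x)) * s ^ k)"
      using vol[OF u s1(2)[OF that(1,2)] s1(3)[OF that(1,2)]] vol[OF w s2(2)[OF that(1,3)] s2(3)[OF that(1,3)]]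
        same[OF that] by simp
    then show ?thesis by (simp only: left_diff_distrib sum_subtractf right_minus_eq)
  qed
  \<comment> \<open>The difference of the two volume polynomials has infinitely many zeros, so all
    its coefficients vanish, in particular the top one.\<close>
  then have "{0..<min s1 s2} \<subseteq> {s. (\<Sum>k\<le>CARD('m). ?d k * s ^ k) = 0}" by auto
  moreover have "infinite {0..<min s1 s2}" using s1(1) s2(1) by (simp add: infinite_Ico)
  ultimately have "infinite {s. (\<Sum>k\<le>CARD('m). ?d k * s ^ k) = 0}" using finite_subset by blast
  then have "?d CARD('m) = 0" using polyfun_finite_roots[of ?d "CARD('m)"] by blast
  then show ?thesis using c(3) by simp
qed

lemma C1_with_jac: "C1_with A g J \<Longrightarrow> C1_with A g (\<lambda>x. jacobian g (at x))"
  using C1_with_imp C1_map_on_with by blast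

lemma jacobian_open_cong:
  fixes f g :: "real^'n \<Rightarrow> real^'n"
  assumes "open S" "x \<in> S" "\<And>y. y \<in> S \<Longrightarrow> f y = g y" "f differentiable (at x)"
  shows "jacobian g (at x) = jacobian f (at x)"
proof (rule jacobian_eqI)
  have "(f has_derivative (\<lambda>h. jacobian f (at x) *v h)) (at x)" 
    using assms(4) jacobian_works by blast
  then show "(g has_derivative (\<lambda>h. jacobian f (at x) *v h)) (at x)"
    using has_derivative_transform_within_open[of f _ x UNIV S g] assms by auto
qed

lemma C1_with_differentiable: "C1_with A g J \<Longrightarrow> x \<in> A \<Longrightarrow> g differentiable (at x)"
  unfolding C1_with_def by (auto intro: differentiableI)

lemma C1_with_cutoff_extension:
  fixes u :: "real^'n \<Rightarrow> real^'n"
  assumes "open A" "C1_with A u J" "compact M" "M \<subseteq> A"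
    and "\<And>x. (c has_derivative (\<lambda>h. D x \<bullet> h)) (at x)" "continuous_on UNIV D" "\<And>x. x \<notin> M \<Longrightarrow> c x = 0"
  defines "v \<equiv> (\<lambda>x. if x \<in> A then c x *\<^sub>R u x else 0)"
  shows "C1_with UNIV v (\<lambda>x. jacobian v (at x))"
proof -
  have "C1_with A (\<lambda>x. c x *\<^sub>R u x) (\<lambda>x. c x *\<^sub>R J x + (\<chi> i j. u x $ i * D x $ j))"
    using assms by (intro C1_with_scale) (auto intro: continuous_on_subset)
  then have "C1_with A v (\<lambda>x. c x *\<^sub>R J x + (\<chi> i j. u x $ i * D x $ j))"
    by (rule C1_with_open_cong) (use assms(1) in \<open>auto simp: v_def\<close>)
  \<comment> \<open>Both local descriptions of \<open>v\<close> are given the common derivative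
    field \<open>jacobian v\<close>, so that they can be glued over the two open sets.\<close>
  then have 1: "C1_with A v (\<lambda>x. jacobian v (at x))" by (rule C1_with_jac)
  have oM: "open (- M)" using assms(3) by (simp add: compact_imp_closed open_Compl)
  have "C1_with (- M) v (\<lambda>x. 0)"
    by (rule C1_with_open_cong[OF C1_with_const[of _ 0] oM]) (use assms(7) in \<open>auto simp: v_def\<close>)
  then have 2: "C1_with (- M) v (\<lambda>x. jacobian v (at x))" by (rule C1_with_jac)
  have "A \<union> - M = UNIV" using assms(4) by auto
  then show ?thesis using C1_with_Un[OF 1 assms(1) 2 oM] by simp
qed

text \<open>A cutoff that equals 1 near \<open>L\<close> turns \<open>u\<close> and \<open>w\<close>
  into global maps agreeing off \<open>L\<close> without changing their Jacobians on
  \<open>L\<close>; off \<open>L\<close> the integrand is 0. The claim is about the difference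
  because the single determinants need not be integrable on \<open>A\<close>.\<close>

lemma has_integral_det_diff_0:
  fixes u w :: "real^'m::{finite,wellorder} \<Rightarrow> real^'m::_"
  assumes "open A" and u: "C1_with A u J" and w: "C1_with A w K"
    and L: "compact L" "L \<subseteq> A" and eq: "\<And>x. x \<in> A - L \<Longrightarrow> u x = w x"
  shows "((\<lambda>x. det (J x) - det (K x)) has_integral 0) A"
proof -
  obtain c :: "(real,'m::_) vec \<Rightarrow> real" and D V M where c: "\<And>x. (c has_derivative (\<lambda>h. D x \<bullet> h)) (at x)" "continuous_on UNIV D"
    "\<And>x. 0 \<le> c x \<and> c x \<le> (1::real)"
    "open V" "L \<subseteq> V" "\<And>x. x \<in> V \<Longrightarrow> c x = 1" "compact M" "M \<subseteq> A" "\<And>x. x \<notin> M \<Longrightarrow> c x = 0"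
    by (rule C1_cutoff[OF L(1) assms(1) L(2)]) (rule that; assumption)
  define E where "E = (\<lambda>v x. if x \<in> A then c x *\<^sub>R v x else (0::(real,'m::_) vec))"
  have cu: "C1_with UNIV (E u) (\<lambda>x. jacobian (E u) (at x))"
    unfolding E_def by (rule C1_with_cutoff_extension[OF assms(1) u c(7,8,1,2,9)])
  have cw: "C1_with UNIV (E w) (\<lambda>x. jacobian (E w) (at x))"
    unfolding E_def by (rule C1_with_cutoff_extension[OF assms(1) w c(7,8,1,2,9)])
  have jac: "jacobian (E v) (at x) = H x" if "C1_with A v H" "x \<in> L" for v H x
  proof -
    have "jacobian (E v) (at x) = jacobian v (at x)"
      by (rule jacobian_open_cong[of "V \<inter> A"])
        (use that c L assms(1) C1_with_differentiable[OF that(1)] in \<open>auto simp: E_def\<close>)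
    then show ?thesis using C1_with_jacobian[OF that(1)] that(2) L(2) by auto
  qed
  have oL: "open (- L)" using L(1) by (simp add: compact_imp_closed open_Compl)
  have Eeq: "E u x = E w x" if "x \<notin> L" for x
    using eq that by (auto simp: E_def)
  have jeq: "jacobian (E w) (at x) = jacobian (E u) (at x)" if "x \<notin> L" for x
    by (rule jacobian_open_cong[OF oL]) (use Eeq that C1_with_differentiable[OF cu] in auto)
  have jeq': "J x = K x" if "x \<in> A - L" for x
  proof -
    have "jacobian w (at x) = jacobian u (at x)"
      by (rule jacobian_open_cong[of "A - L"]) 
        (use eq that C1_with_differentiable[OF u] assms(1) oL open_Int[OF assms(1) oL] in \<open>auto simp: Diff_eq\<close>)
    then show ?thesis using C1_with_jacobian[OF u] C1_with_jacobian[OF w] that by auto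
  qed
  obtain r where r: "r > 0" "\<And>x. x \<in> L \<Longrightarrow> norm x \<le> r"
    using compact_imp_bounded[OF L(1)] by (auto simp: bounded_pos)
  let ?B = "cball (0::(real,'m::_) vec) (r + 1)"
  have far: "E u x = E w x" if "r < norm x" for x using Eeq[of x] r(2)[of x] that by linarith
  have ci: "(\<lambda>x. det (jacobian (E v) (at x))) integrable_on ?B"
    if "C1_with UNIV (E v) (\<lambda>x. jacobian (E v) (at x))" for v
    using that by (intro integrable_on_compact continuous_on_det) (auto simp: C1_with_def intro: continuous_on_subset)
  have "((\<lambda>x. det (jacobian (E u) (at x)) - det (jacobian (E w) (at x))) has_integral 0) ?B"
    using has_integral_diff[OF integrable_integral[OF ci[OF cu]] integrable_integral[OF ci[OF cw]]]
      integral_det_eq[OF cu cw, of r "r + 1", OF far] r(1) by simp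
  then have "((\<lambda>x. if x \<in> L then det (J x) - det (K x) else 0) has_integral 0) ?B"
    by (rule has_integral_eq[rotated]) (auto simp: jac[OF u] jac[OF w] jeq)
  moreover have "L \<subseteq> ?B" using r by fastforce
  ultimately have "((\<lambda>x. det (J x) - det (K x)) has_integral 0) L" by simp
  then have "((\<lambda>x. if x \<in> L then det (J x) - det (K x) else 0) has_integral 0) A"
    using L(2) by simp
  then show ?thesis
    by (rule has_integral_eq[rotated]) (use jeq' in auto)
qed

subsection \<open>Regular degree and homotopy invariance\<close>

lemma C1_locally_injective:
  fixes g :: "real^'n \<Rightarrow> real^'n"
  assumes "open A" "C1_with A g J" "a \<in> A" "det (J a) \<noteq> 0"
  obtains r where "r > 0" "ball a r \<subseteq> A" "inj_on g (ball a r)" "\<And>x. x \<in> ball a r \<Longrightarrow> sgn (det (J x)) = sgn (det (J a))"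
proof -
  let ?N = "real CARD('n) * real CARD('n)"
  obtain B where B: "B ** J a = mat 1"
    using assms(4) invertible_det_nz invertible_left_inverse by blast
  have cont: "continuous (at a) J"
    using assms by (simp add: C1_with_def continuous_on_eq_continuous_at)
  obtain r0 where r0: "r0 > 0" "ball a r0 \<subseteq> A" "inj_on g (ball a r0)"
  proof (rule has_derivative_locally_injective[OF assms(3,1), of "\<lambda>h. B *v h" "\<lambda>x h. J x *v h" g])
    show "bounded_linear (\<lambda>h. B *v h)" by (rule matrix_vector_mul_bounded_linear)
    show "(\<lambda>h. B *v h) \<circ> (\<lambda>h. J a *v h) = id" by (auto simp: fun_eq_iff matrix_vector_mul_assoc B)
    show "(g has_derivative (\<lambda>h. J x *v h)) (at x)" if "x \<in> A" for x using assms that by (auto simp: C1_with_def)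
    fix e :: real assume e: "e > 0"
    have pos: "0 < ?N + 1" by (simp add: add_pos_pos)
    then obtain d where d: "d > 0" "\<And>x. dist x a < d \<Longrightarrow> dist (J x) (J a) < e / (?N + 1)"
      using cont[unfolded continuous_at_eps_delta, rule_format, of "e / (?N + 1)"] divide_pos_pos[OF e pos] by blast
    have "onorm (\<lambda>v. J x *v v - J a *v v) < e" if "dist a x < d" for x
    proof -
      have "onorm (\<lambda>v. J x *v v - J a *v v) = onorm (\<lambda>v. (J x - J a) *v v)"
        by (simp add: matrix_vector_mult_diff_rdistrib)
      also have "\<dots> \<le> ?N * norm (J x - J a)" by (rule onorm_matrix_le)
      also have "\<dots> \<le> (?N + 1) * norm (J x - J a)" by (intro mult_right_mono) auto
      also have "\<dots> < (?N + 1) * (e / (?N + 1))" 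
        using d(2)[of x] that pos by (intro mult_strict_left_mono) (auto simp: dist_norm dist_commute norm_minus_commute)
      also have "\<dots> = e" using pos by simp
      finally show ?thesis .
    qed
    then show "\<exists>d>0. \<forall>x. dist a x < d \<longrightarrow> onorm (\<lambda>v. J x *v v - J a *v v) < e" using d(1) by blast
  qed blast
  have "continuous_on A (\<lambda>x. det (J x))" using assms(2) by (auto simp: C1_with_def intro: continuous_on_det)
  then have "continuous (at a) (\<lambda>x. det (J x))" using assms continuous_on_eq_continuous_at by blast
  \<comment> \<open>A deviation smaller than \<open>\<bar>det (J a)\<bar>\<close> cannot change the
    sign of the determinant.\<close>
  then obtain d where d: "d > 0" "\<And>x. dist x a < d \<Longrightarrow> dist (det (J x)) (det (J a)) < \<bar>det (J a)\<bar>"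
    using assms(4) unfolding continuous_at_eps_delta zero_less_abs_iff[symmetric] by blast
  show ?thesis
  proof (rule that[of "min r0 d"])
    show "min r0 d > 0" "ball a (min r0 d) \<subseteq> A" "inj_on g (ball a (min r0 d))"
      using r0 d(1) by (auto intro: inj_on_subset)
    show "sgn (det (J x)) = sgn (det (J a))" if "x \<in> ball a (min r0 d)" for x
      using d(2)[of x] that by (auto simp: dist_commute dist_real_def sgn_if abs_if split: if_splits)
  qed
qed

text \<open>Local injectivity isolates every preimage of a regular value, and a compact set of
  isolated points is finite.\<close>

lemma finite_regular_preimage_compact:
  fixes g :: "real^'n \<Rightarrow> real^'n"
  assumes "open A" "C1_map_on A g" "regular_value_on A g z" "compact S" "S \<subseteq> A"
  shows "finite {x \<in> S. g x = z}"
proof -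
  let ?X = "{x \<in> S. g x = z}"
  have "continuous_on A g" using C1_map_on_with C1_with_continuous_on assms(2) by blast
  then have "closed ?X"
    by (intro continuous_closed_preimage_constant continuous_on_subset[OF _ assms(5)] compact_imp_closed[OF assms(4)])
  then have "compact (?X \<inter> S)" using assms(4) by (intro closed_Int_compact)
  moreover have "?X \<inter> S = ?X" by blast
  ultimately have c: "compact ?X" by simp
  have l: "\<not> x islimpt ?X" if "x \<in> ?X" for x
  proof -
    have xA: "x \<in> A" "g x = z" using that assms(5) by blast+
    have nz: "det (jacobian g (at x)) \<noteq> 0" using assms(3) xA unfolding regular_value_on_def by blast
    obtain r where r: "r > 0" "ball x r \<subseteq> A" "inj_on g (ball x r)"
      by (rule C1_locally_injective[OF assms(1) C1_map_on_with[THEN iffD1, OF assms(2)] xA(1) nz]) (rule that; assumption)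
    have "y = x" if "y \<in> ?X \<inter> ball x r" for y
    proof (rule inj_onD[OF r(3)])
      show "g y = g x" using that xA(2) by simp
      show "y \<in> ball x r" using that by blast
      show "x \<in> ball x r" using r(1) by simp
    qed
    moreover have "x \<in> ball x r" "open (ball x r)" using r(1) by simp_all
    ultimately show ?thesis unfolding islimpt_def by blast
  qed
  have "finite (?X \<inter> ?X)" by (rule finite_not_islimpt_in_compact[OF c]) (rule l)
  then show ?thesis by (simp only: Int_absorb)
qed

text \<open>As \<open>z\<close> is not attained on the frontier, its preimage in \<open>A\<close> is
  also its preimage in \<open>closure A\<close> and hence compact.\<close>

lemma finite_regular_preimage:
  fixes g :: "real^'n \<Rightarrow> real^'n"
  assumes "open A" "bounded A" "continuous_on (closure A) g" "C1_map_on A g" "regular_value_on A g z"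
    "z \<notin> g ` frontier A"
  shows "finite {x \<in> A. g x = z}"
proof -
  let ?X = "{x \<in> closure A. g x = z}"
  have X: "{x \<in> A. g x = z} = ?X" using assms(1,6) closure_subset[of A] by (auto simp: frontier_def interior_open)
  have "closed ?X" by (intro continuous_closed_preimage_constant assms(3) closed_closure)
  moreover have "bounded ?X" by (rule bounded_subset[OF bounded_closure[OF assms(2)]]) blast
  ultimately have "compact ?X" by (simp add: compact_eq_bounded_closed)
  moreover have "?X \<subseteq> A" using X by blast
  ultimately have "finite {x \<in> ?X. g x = z}" by (rule finite_regular_preimage_compact[OF assms(1,4,5)])
  moreover have "{x \<in> ?X. g x = z} = {x \<in> A. g x = z}" using X by blast
  ultimately show ?thesis by (simp only:)
qed

section \<open>Integral representation of the regular degree\<close>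

lemma has_integral_change_of_variables_open:
  fixes g :: "real^'m::{finite,wellorder} \<Rightarrow> real^'m::_" and f :: "real^'m::_ \<Rightarrow> real"
  assumes S: "open S" and g: "C1_with S g J" and inj: "inj_on g S"
    and f: "continuous_on UNIV f" "\<And>y. y \<notin> g ` S \<Longrightarrow> f y = 0" "\<And>y. d \<le> dist z y \<Longrightarrow> f y = 0"
  shows "((\<lambda>x. f (g x) * \<bar>det (J x)\<bar>) has_integral integral UNIV f) S"
proof -
  \<comment> \<open>The change of variables theorem takes vector-valued integrands, hence the
    passage through \<open>real^1\<close>.\<close>
  let ?F = "\<lambda>y. vec (f y) :: real^1"
  have "f absolutely_integrable_on cball z d"
    by (intro absolutely_integrable_onI integrable_on_compact continuous_on_norm continuous_on_subset[OF f(1)]) auto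
  moreover have "(\<lambda>y. if y \<in> cball z d then f y else 0) = f" using f(3) by (force simp: fun_eq_iff)
  ultimately have "f absolutely_integrable_on UNIV"
    using absolutely_integrable_restrict_UNIV[of "cball z d" f] by simp
  moreover have fS: "(\<lambda>y. if y \<in> g ` S then f y else 0) = f" using f(2) by (auto simp: fun_eq_iff)
  ultimately have "f absolutely_integrable_on (g ` S)"
    using absolutely_integrable_restrict_UNIV[of "g ` S" f] by simp
  then have F: "?F absolutely_integrable_on (g ` S)"
    by (simp add: absolutely_integrable_on_1_iff)
  have intF: "integral (g ` S) ?F = vec (integral UNIV f)"
    using Henstock_Kurzweil_Integration.integral_restrict_UNIV[of "g ` S" f] fS by (simp add: integral_on_1_eq)
  have "S \<in> sets lebesgue" using S by (simp add: lmeasurable_open borel_open)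
  moreover have "(g has_derivative (\<lambda>h. J x *v h)) (at x within S)" if "x \<in> S" for x
    using g that by (auto simp: C1_with_def intro: has_derivative_at_withinI)
  ultimately have "(\<lambda>x. \<bar>det (matrix (\<lambda>h. J x *v h))\<bar> *\<^sub>R ?F (g x)) absolutely_integrable_on S \<and>
      integral S (\<lambda>x. \<bar>det (matrix (\<lambda>h. J x *v h))\<bar> *\<^sub>R ?F (g x)) = vec (integral UNIV f)"
    using has_absolute_integral_change_of_variables[of S g "\<lambda>x h. J x *v h" ?F "vec (integral UNIV f)"] inj F intF
    by blast
  then have *: "(\<lambda>x. \<bar>det (J x)\<bar> *\<^sub>R ?F (g x)) integrable_on S"
      "integral S (\<lambda>x. \<bar>det (J x)\<bar> *\<^sub>R ?F (g x)) = vec (integral UNIV f)"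
    by (auto simp: absolutely_integrable_on_def)
  have "(\<lambda>x. f (g x) * \<bar>det (J x)\<bar>) integrable_on S"
    using *(1) by (simp add: integrable_on_1_iff mult.commute)
  moreover have "integral S (\<lambda>x. f (g x) * \<bar>det (J x)\<bar>) = integral UNIV f"
    using *(2) by (simp add: integral_on_1_eq vec_eq_iff mult.commute)
  ultimately show ?thesis by (simp add: has_integral_integrable_integral)
qed


text \<open>A test function concentrated near \<open>z\<close> only sees small disjoint balls around
  the finitely many preimages. On each ball \<open>g\<close> is injective and
  \<open>det (J x)\<close> has constant sign, so the change of variables contributes that sign times
  the integral of \<open>f\<close>.\<close>

lemma has_integral_regular_degree:
  fixes g :: "real^'m::{finite,wellorder} \<Rightarrow> real^'m::_"
  assumes A: "open A" "bounded A" and cont: "continuous_on (closure A) g" and g: "C1_with A g J"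
    and reg: "regular_value_on A g z" and z: "z \<notin> g ` frontier A"
  shows "\<exists>d>0. \<forall>f::real^'m::_ \<Rightarrow> real. continuous_on UNIV f \<longrightarrow> (\<forall>y. d \<le> dist z y \<longrightarrow> f y = 0) \<longrightarrow>
      ((\<lambda>x. f (g x) * det (J x)) has_integral (regular_degree g A z * integral UNIV f)) A"
proof -
  define X where "X = {x \<in> A. g x = z}"
  have finX: "finite X"
    unfolding X_def by (rule finite_regular_preimage[OF A cont C1_with_imp[OF g] reg z])
  have nz: "det (J x) \<noteq> 0" if "x \<in> X" for x
    using reg that C1_with_jacobian[OF g] unfolding X_def regular_value_on_def by fastforce
  have "\<exists>r. r > 0 \<and> ball x r \<subseteq> A \<and> inj_on g (ball x r) \<and> (\<forall>y\<in>ball x r. sgn (det (J y)) = sgn (det (J x)))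
      \<and> (\<forall>y\<in>X. y \<noteq> x \<longrightarrow> 2 * r \<le> dist x y)" if x: "x \<in> X" for x
  proof -
    have xA: "x \<in> A" using x by (simp add: X_def)
    obtain r where r: "r > 0" "ball x r \<subseteq> A" "inj_on g (ball x r)" "\<And>y. y \<in> ball x r \<Longrightarrow> sgn (det (J y)) = sgn (det (J x))"
      by (rule C1_locally_injective[OF A(1) g xA nz[OF x]]) (rule that; assumption)
    \<comment> \<open>Radii of at most half the distance to the other preimages make the balls
      disjoint.\<close>
    obtain d where d: "d > 0" "\<forall>y\<in>X. y \<noteq> x \<longrightarrow> d \<le> dist x y"
      using finite_set_avoid[OF finX, of x] by blast
    show ?thesis
    proof (intro exI[of _ "min r (d / 2)"] conjI ballI impI)
      show "inj_on g (ball x (min r (d / 2)))" using r(3) by (rule inj_on_subset) auto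
      show "2 * min r (d / 2) \<le> dist x y" if "y \<in> X" "y \<noteq> x" for y
      proof -
        have "d \<le> dist x y" using d(2) that by blast
        then show ?thesis by (simp add: min_def)
      qed
      show "0 < min r (d / 2)" using r(1) d(1) by simp
      show "ball x (min r (d / 2)) \<subseteq> A" using r(2) by auto
      show "sgn (det (J y)) = sgn (det (J x))" if "y \<in> ball x (min r (d / 2))" for y
        using r(4)[of y] that by simp
    qed
  qed
  then have "\<forall>x\<in>X. \<exists>r. r > 0 \<and> ball x r \<subseteq> A \<and> inj_on g (ball x r) \<and> (\<forall>y\<in>ball x r. sgn (det (J y)) = sgn (det (J x)))
      \<and> (\<forall>y\<in>X. y \<noteq> x \<longrightarrow> 2 * r \<le> dist x y)" by blast
  from bchoice[OF this] obtain r where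
    "\<forall>x\<in>X. r x > 0 \<and> ball x (r x) \<subseteq> A \<and> inj_on g (ball x (r x)) \<and> (\<forall>y\<in>ball x (r x). sgn (det (J y)) = sgn (det (J x)))
      \<and> (\<forall>y\<in>X. y \<noteq> x \<longrightarrow> 2 * r x \<le> dist x y)" ..
  then have r: "\<And>x. x \<in> X \<Longrightarrow> r x > 0" "\<And>x. x \<in> X \<Longrightarrow> ball x (r x) \<subseteq> A" 
    "\<And>x. x \<in> X \<Longrightarrow> inj_on g (ball x (r x))" 
    "\<And>x y. x \<in> X \<Longrightarrow> y \<in> ball x (r x) \<Longrightarrow> sgn (det (J y)) = sgn (det (J x))"
    "\<And>x y. x \<in> X \<Longrightarrow> y \<in> X \<Longrightarrow> y \<noteq> x \<Longrightarrow> 2 * r x \<le> dist x y"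
    by blast+
  define N where "N = (\<Union>x\<in>X. ball x (r x))"
  have NA: "N \<subseteq> A" using r(2) by (auto simp: N_def)
  have XN: "X \<subseteq> N" using r(1) by (auto simp: N_def)
  have disj: "ball x (r x) \<inter> ball y (r y) = {}" if "x \<in> X" "y \<in> X" "x \<noteq> y" for x y
  proof -
    have "2 * r x \<le> dist x y" using r(5)[OF that(1,2)] that(3) by blast
    moreover have "2 * r y \<le> dist y x" using r(5)[OF that(2,1) that(3)] .
    ultimately have "r x + r y \<le> dist x y" by (simp add: dist_commute)
    then show ?thesis by (rule disjoint_ballI)
  qed
  have "open N" unfolding N_def by auto
  then have "closed (closure A - N)" by (simp add: closed_Diff)
  then have "compact (closure A - N)"
    using bounded_subset[OF bounded_closure[OF A(2)] Diff_subset] by (simp add: compact_eq_bounded_closed)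
  then have "compact (g ` (closure A - N))"
    by (rule compact_continuous_image[rotated]) (use cont in \<open>auto intro: continuous_on_subset\<close>)
  moreover have "z \<notin> g ` (closure A - N)"
  proof
    assume "z \<in> g ` (closure A - N)"
    then obtain y where y: "y \<in> closure A" "y \<notin> N" "z = g y" by blast
    show False
    proof (cases "y \<in> A")
      case True
      then have "y \<in> X" using y(3) by (simp add: X_def)
      then show False using XN y(2) by blast
    next
      case False
      then have "y \<in> frontier A" using y(1) A(1) by (simp add: frontier_def interior_open)
      then show False using z y(3) by blast
    qed
  qed
  \<comment> \<open>Within distance \<open>d1\<close> of \<open>z\<close> all preimages lie in
    \<open>N\<close>; within distance \<open>d2\<close>, chosen below, every point lies in the image
    of each of the small balls.\<close>
  ultimately obtain d1 where d1: "d1 > 0" "\<And>x. x \<in> closure A - N \<Longrightarrow> d1 \<le> dist z (g x)"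
    using separate_point_closed[OF compact_imp_closed, of "g ` (closure A - N)" z] by blast
  have op: "open (g ` ball x (r x))" if "x \<in> X" for x
    using C1_with_continuous_on[OF g] r(2,3)[OF that]
    by (intro invariance_of_domain) (auto intro: continuous_on_subset)
  have "open (\<Inter>x\<in>X. g ` ball x (r x))" using finX op by (intro open_INT) auto
  moreover have "z \<in> (\<Inter>x\<in>X. g ` ball x (r x))"
  proof
    fix x assume "x \<in> X"
    then have "z = g x" "x \<in> ball x (r x)" using r(1)[of x] by (simp_all add: X_def)
    then show "z \<in> g ` ball x (r x)" by blast
  qed
  ultimately obtain d2 where d2: "d2 > 0" "ball z d2 \<subseteq> (\<Inter>x\<in>X. g ` ball x (r x))"
    by (rule openE)
  show ?thesis
  proof (intro exI[of _ "min d1 d2"] conjI allI impI)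
    show "min d1 d2 > 0" using d1 d2 by simp
    fix f :: "(real,'m::_) vec \<Rightarrow> real" assume f: "continuous_on UNIV f" and "\<forall>y. min d1 d2 \<le> dist z y \<longrightarrow> f y = 0"
    then have f0: "\<And>y. min d1 d2 \<le> dist z y \<Longrightarrow> f y = 0" by blast
    have loc: "((\<lambda>y. f (g y) * det (J y)) has_integral (sgn (det (J x)) * integral UNIV f)) (ball x (r x))" if x: "x \<in> X" for x
    proof -
      have "f y = 0" if "y \<notin> g ` ball x (r x)" for y
      proof (rule f0)
        have "y \<notin> ball z d2" using that d2(2) x by blast
        then show "min d1 d2 \<le> dist z y" by simp
      qed
      then have "((\<lambda>y. f (g y) * \<bar>det (J y)\<bar>) has_integral integral UNIV f) (ball x (r x))"
        by (rule has_integral_change_of_variables_open[OF open_ball C1_with_subset[OF g r(2)[OF x]] r(3)[OF x] f _ f0])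
      then have "((\<lambda>y. sgn (det (J x)) * (f (g y) * \<bar>det (J y)\<bar>)) has_integral (sgn (det (J x)) * integral UNIV f)) (ball x (r x))"
        by (rule has_integral_mult_right)
      then show ?thesis
      proof (rule has_integral_eq[rotated])
        fix y assume "y \<in> ball x (r x)"
        then have "sgn (det (J x)) = sgn (det (J y))" using r(4)[OF x] by simp
        then have "sgn (det (J x)) * (f (g y) * \<bar>det (J y)\<bar>) = f (g y) * (sgn (det (J y)) * \<bar>det (J y)\<bar>)" by simp
        then show "sgn (det (J x)) * (f (g y) * \<bar>det (J y)\<bar>) = f (g y) * det (J y)"
          by (simp only: sgn_mult_abs)
      qed
    qed
    have "((\<lambda>y. f (g y) * det (J y)) has_integral (\<Sum>x\<in>X. sgn (det (J x)) * integral UNIV f)) N"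
      unfolding N_def
    proof (rule has_integral_UN[OF finX loc])
      show "pairwise (\<lambda>x y. negligible (ball x (r x) \<inter> ball y (r y))) X"
        unfolding pairwise_def using disj by simp
    qed
    then have "((\<lambda>y. if y \<in> N then f (g y) * det (J y) else 0) has_integral (\<Sum>x\<in>X. sgn (det (J x)) * integral UNIV f)) A"
      using NA by simp
    then have "((\<lambda>y. f (g y) * det (J y)) has_integral (\<Sum>x\<in>X. sgn (det (J x)) * integral UNIV f)) A"
    proof (rule has_integral_eq[rotated])
      fix y assume "y \<in> A"
      then show "(if y \<in> N then f (g y) * det (J y) else 0) = f (g y) * det (J y)"
      proof (cases "y \<in> N")
        case False
        then have "d1 \<le> dist z (g y)" using d1(2) \<open>y \<in> A\<close> closure_subset by blast
        then show ?thesis using f0[of "g y"] by simp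
      qed simp
    qed
    moreover have "regular_degree g A z = (\<Sum>x\<in>X. sgn (det (J x)))"
      unfolding regular_degree_def X_def by (rule sum.cong) (auto simp: C1_with_jacobian[OF g])
    ultimately show "((\<lambda>x. f (g x) * det (J x)) has_integral (regular_degree g A z * integral UNIV f)) A"
      by (simp add: sum_distrib_right)
  qed
qed


text \<open>Both maps are composed with a map \<open>P\<close> whose Jacobian determinant is a bump
  function \<open>f\<close> at \<open>z\<close>. The composed maps agree off \<open>L\<close>, so
  their determinants have the same integral; by localization these integrals are the two regular
  degrees times the nonzero integral of \<open>f\<close>.\<close>

lemma regular_degree_eq_of_eq_near_frontier:
  fixes g h :: "real^'m::{finite,wellorder} \<Rightarrow> real^'m::_"
  assumes A: "open A" "bounded A"
    and g: "continuous_on (closure A) g" "C1_map_on A g" "regular_value_on A g z" "z \<notin> g ` frontier A"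
    and h: "continuous_on (closure A) h" "C1_map_on A h" "regular_value_on A h z" "z \<notin> h ` frontier A"
    and L: "compact L" "L \<subseteq> A" "\<And>x. x \<in> A - L \<Longrightarrow> g x = h x"
  shows "regular_degree g A z = regular_degree h A z"
proof -
  define J where "J = (\<lambda>x. jacobian g (at x))"
  define K where "K = (\<lambda>x. jacobian h (at x))"
  have gJ: "C1_with A g J" and hK: "C1_with A h K" using g(2) h(2) by (auto simp: C1_map_on_with J_def K_def)
  obtain d1 where d1: "d1 > 0"
    "\<forall>f::(real,'m::_) vec \<Rightarrow> real. continuous_on UNIV f \<longrightarrow> (\<forall>y. d1 \<le> dist z y \<longrightarrow> f y = 0) \<longrightarrow>
      ((\<lambda>x. f (g x) * det (J x)) has_integral (regular_degree g A z * integral UNIV f)) A"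
    using has_integral_regular_degree[OF A g(1) gJ g(3,4)] by blast
  obtain d2 where d2: "d2 > 0"
    "\<forall>f::(real,'m::_) vec \<Rightarrow> real. continuous_on UNIV f \<longrightarrow> (\<forall>y. d2 \<le> dist z y \<longrightarrow> f y = 0) \<longrightarrow>
      ((\<lambda>x. f (h x) * det (K x)) has_integral (regular_degree h A z * integral UNIV f)) A"
    using has_integral_regular_degree[OF A h(1) hK h(3,4)] by blast
  \<comment> \<open>Division by the dimension puts the open cube of half side \<open>e\<close>
    around \<open>z\<close> inside the ball of radius \<open>min d1 d2\<close>, by the comparison of
    the Euclidean norm with the l1 norm.\<close>
  define e where "e = min d1 d2 / real CARD('m)"
  have e: "e > 0" using d1(1) d2(1) by (simp add: e_def)
  define f where "f = (\<lambda>y::(real,'m::_) vec. \<Prod>i\<in>UNIV. tent e (y $ i - z $ i))"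
  \<comment> \<open>\<open>P\<close> acts coordinatewise, so its Jacobian \<open>Q\<close> is
    diagonal and the determinant is the product of tents \<open>f\<close>.\<close>
  define P where "P = (\<lambda>y::(real,'m::_) vec. (\<chi> i. ramp e (y $ i - z $ i)))"
  define Q where "Q = (\<lambda>y::(real,'m::_) vec. (\<chi> i j. if i = j then tent e (y $ i - z $ i) else 0))"
  have fc: "continuous_on UNIV f" unfolding f_def by (intro continuous_intros continuous_on_tent)
  have f0: "f y = 0" if "min d1 d2 \<le> dist z y" for y
  proof -
    have "\<exists>i. e \<le> \<bar>y $ i - z $ i\<bar>"
    proof (rule ccontr)
      assume "\<not> ?thesis"
      then have "\<And>i. \<bar>(y - z) $ i\<bar> < e" by (simp add: not_le)
      then have "(\<Sum>i\<in>UNIV. \<bar>(y - z) $ i\<bar>) < (\<Sum>i\<in>(UNIV::'m set). e)" by (intro sum_strict_mono) auto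
      also have "\<dots> = min d1 d2" by (simp add: e_def)
      finally have "dist z y < min d1 d2" using norm_le_l1_cart[of "y - z"] by (simp add: dist_norm norm_minus_commute)
      with that show False by simp
    qed
    then obtain i where "tent e (y $ i - z $ i) = 0" using tent_eq_0 by blast
    then show ?thesis unfolding f_def by (intro prod_zero) auto
  qed
  have detQ: "det (Q y) = f y" for y
    unfolding Q_def f_def by (subst det_diagonal) auto
  have PQ: "C1_with UNIV P Q"
    unfolding C1_with_def
  proof safe
    fix y
    have "((\<lambda>y. P y $ i) has_derivative (\<lambda>v. (Q y *v v) $ i)) (at y)" for i
    proof -
      have "((\<lambda>y. y $ i - z $ i) has_derivative (\<lambda>v. v $ i)) (at y)"
        using has_derivative_diff[OF bounded_linear_imp_has_derivative[OF bounded_linear_vec_nth] has_derivative_const] by simp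
      moreover have "(ramp e has_derivative (\<lambda>t. tent e (y $ i - z $ i) * t)) (at (y $ i - z $ i))"
        using ramp_deriv[of e "y $ i - z $ i"] e by (simp add: has_field_derivative_def)
      ultimately have "((\<lambda>y. ramp e (y $ i - z $ i)) has_derivative (\<lambda>v. tent e (y $ i - z $ i) * v $ i)) (at y)"
        by (rule diff_chain_at[unfolded o_def])
      moreover have "(Q y *v v) $ i = tent e (y $ i - z $ i) * v $ i" for v
        by (simp add: Q_def matrix_vector_mult_def if_distrib[of "\<lambda>x. x * _"] cong: if_cong)
      ultimately show ?thesis by (simp add: P_def)
    qed
    then show "(P has_derivative (\<lambda>v. Q y *v v)) (at y)"
      by (subst has_derivative_componentwise_within) (auto simp: Basis_vec_def inner_axis)
  next
    show "continuous_on UNIV Q" unfolding Q_def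
    proof (intro continuous_on_matrix_entries)
      show "continuous_on UNIV (\<lambda>y. (\<chi> i j. if i = j then tent e (y $ i - z $ i) else 0) $ i $ j)" for i j
        by (cases "i = j") (auto intro!: continuous_intros continuous_on_tent)
    qed
  qed
  have u: "C1_with A (\<lambda>x. P (g x)) (\<lambda>x. Q (g x) ** J x)" by (rule C1_with_compose[OF gJ PQ]) auto
  have w: "C1_with A (\<lambda>x. P (h x)) (\<lambda>x. Q (h x) ** K x)" by (rule C1_with_compose[OF hK PQ]) auto
  have "((\<lambda>x. det (Q (g x) ** J x) - det (Q (h x) ** K x)) has_integral 0) A"
    by (rule has_integral_det_diff_0[OF A(1) u w L(1,2)]) (simp add: L(3))
  then have "((\<lambda>x. f (g x) * det (J x) - f (h x) * det (K x)) has_integral 0) A"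
    by (simp add: det_mul detQ)
  moreover have "((\<lambda>x. f (g x) * det (J x) - f (h x) * det (K x)) has_integral
      (regular_degree g A z * integral UNIV f - regular_degree h A z * integral UNIV f)) A"
    using f0 by (intro has_integral_diff d1(2)[rule_format] d2(2)[rule_format] fc) auto
  ultimately have eq: "(regular_degree g A z - regular_degree h A z) * integral UNIV f = 0"
    unfolding left_diff_distrib by (rule has_integral_unique[rotated])
  \<comment> \<open>A nonnegative continuous function with integral 0 over a box vanishes in it, but
    \<open>f z\<close> is a product of positive factors.\<close>
  have "integral UNIV f \<noteq> 0"
  proof
    assume "integral UNIV f = 0"
    obtain B where B: "cball z (min d1 d2) \<subseteq> cbox (- B) B" 
      using bounded_subset_cbox_symmetric[OF bounded_cball, of z "min d1 d2"] by blast
    have fB: "f y = 0" if "y \<notin> cbox (- B) B" for y using f0[of y] B that by force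
    have "(\<lambda>y. if y \<in> cbox (- B) B then f y else 0) = f" using fB by (auto simp: fun_eq_iff)
    then have "integral (cbox (- B) B) f = 0"
      using Henstock_Kurzweil_Integration.integral_restrict_UNIV[of "cbox (- B) B" f] \<open>integral UNIV f = 0\<close> by simp
    moreover have "f integrable_on cbox (- B) B" by (intro integrable_continuous continuous_on_subset[OF fc]) auto
    ultimately have hi: "(f has_integral 0) (cbox (- B) B)" by (simp add: has_integral_integrable_integral)
    have "ball z (min d1 d2) \<subseteq> interior (cbox (- B) B)"
      using B by (intro interior_maximal) (auto simp: subset_iff)
    then have zb: "z \<in> box (- B) B" using d1(1) d2(1) by (auto simp: interior_cbox)
    have "f z = 0"
      using has_integral_0_cbox_imp_0[OF continuous_on_subset[OF fc] _ hi, of z] zb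
      by (auto simp: f_def intro: prod_nonneg tent_nonneg box_subset_cbox[THEN subsetD])
    then show False using tent_pos[OF e] by (simp add: f_def)
  qed
  then show ?thesis using eq by simp
qed

lemma regular_degree_cong:
  assumes "{x \<in> A. g x = z} = {x \<in> A. h x = z}"
    and "\<And>x. x \<in> A \<Longrightarrow> h x = z \<Longrightarrow> jacobian g (at x) = jacobian h (at x)"
  shows "regular_degree g A z = regular_degree h A z"
  unfolding regular_degree_def assms(1) by (rule sum.cong) (use assms(2) in auto)

text \<open>This set is the projection to \<open>S\<close> of a level set of the straight-line
  homotopy on the compact product of \<open>{0..1}\<close> and \<open>S\<close>.\<close>

lemma compact_segment_preimage:
  fixes g h :: "'a::metric_space \<Rightarrow> 'b::real_normed_vector"
  assumes "compact S" "continuous_on S g" "continuous_on S h"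
  shows "compact {x \<in> S. z \<in> closed_segment (g x) (h x)}"
proof -
  let ?f = "\<lambda>p. (1 - fst p) *\<^sub>R g (snd p) + fst p *\<^sub>R h (snd p)"
  let ?T = "{0..1::real} \<times> S"
  have c: "continuous_on ?T ?f"
    by (intro continuous_intros continuous_on_compose2[OF assms(2)] continuous_on_compose2[OF assms(3)]) auto
  have cT: "compact ?T" by (intro compact_Times assms(1)) simp
  then have "closed {p \<in> ?T. ?f p = z}"
    by (intro continuous_closed_preimage_constant[OF c] compact_imp_closed)
  then have "compact ({p \<in> ?T. ?f p = z} \<inter> ?T)" using cT by (intro closed_Int_compact)
  moreover have "{p \<in> ?T. ?f p = z} \<inter> ?T = {p \<in> ?T. ?f p = z}" by blast
  ultimately have "compact (snd ` {p \<in> ?T. ?f p = z})"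
    by (intro compact_continuous_image continuous_on_snd continuous_on_id) simp
  moreover have "snd ` {p \<in> ?T. ?f p = z} = {x \<in> S. z \<in> closed_segment (g x) (h x)}" (is "?L = ?R")
  proof
    show "?L \<subseteq> ?R" by (auto simp: in_segment)
    show "?R \<subseteq> ?L"
    proof
      fix x assume "x \<in> ?R"
      then obtain u where "x \<in> S" "0 \<le> u" "u \<le> 1" "z = (1 - u) *\<^sub>R g x + u *\<^sub>R h x" by (auto simp: in_segment)
      then have "(u, x) \<in> {p \<in> ?T. ?f p = z}" by simp
      then show "x \<in> ?L" by (metis (no_types, lifting) imageI snd_conv)
    qed
  qed
  ultimately show ?thesis by simp
qed

text \<open>With a cutoff that is 1 near the points whose segment contains \<open>z\<close>, the
  blend \<open>G\<close> of \<open>g\<close> and \<open>h\<close> equals \<open>g\<close> near the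
  frontier. Since \<open>G x\<close> stays on the segment, \<open>G\<close> takes the value
  \<open>z\<close> only where it coincides locally with \<open>h\<close>, so it has the regular
  degree of \<open>h\<close>.\<close>

lemma regular_degree_homotopy_wellorder:
  fixes g h :: "real^'m::{finite,wellorder} \<Rightarrow> real^'m::_"
  assumes A: "open A" "bounded A"
    and g: "continuous_on (closure A) g" "C1_map_on A g" "regular_value_on A g z"
    and h: "continuous_on (closure A) h" "C1_map_on A h" "regular_value_on A h z"
    and seg: "\<And>x. x \<in> frontier A \<Longrightarrow> z \<notin> closed_segment (g x) (h x)"
  shows "regular_degree g A z = regular_degree h A z"
proof -
  let ?K = "{x \<in> closure A. z \<in> closed_segment (g x) (h x)}"
  have K: "compact ?K"
    by (rule compact_segment_preimage[OF _ g(1) h(1)]) (simp add: A(2) compact_closure)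
  have KA: "?K \<subseteq> A" using seg A(1) by (auto simp: frontier_def interior_open)
  obtain c :: "(real,'m::_) vec \<Rightarrow> real" and D V L where c: "\<And>x. (c has_derivative (\<lambda>h. D x \<bullet> h)) (at x)" "continuous_on UNIV D"
    "\<And>x. 0 \<le> c x \<and> c x \<le> (1::real)"
    "open V" "?K \<subseteq> V" "\<And>x. x \<in> V \<Longrightarrow> c x = 1" "compact L" "L \<subseteq> A" "\<And>x. x \<notin> L \<Longrightarrow> c x = 0"
    by (rule C1_cutoff[OF K A(1) KA]) (rule that; assumption)
  define J where "J = (\<lambda>x. jacobian g (at x))"
  define H where "H = (\<lambda>x. jacobian h (at x))"
  have gJ: "C1_with A g J" and hH: "C1_with A h H" using g(2) h(2) by (auto simp: C1_map_on_with J_def H_def)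
  define G where "G = (\<lambda>x. g x + c x *\<^sub>R (h x - g x))"
  have cc: "continuous_on UNIV c"
    by (intro continuous_at_imp_continuous_on ballI has_derivative_continuous[OF c(1)])
  have G1: "C1_map_on A G" unfolding G_def
    by (rule C1_with_imp[OF C1_with_add[OF gJ C1_with_scale[OF c(1) continuous_on_subset[OF c(2)] C1_with_diff[OF hH gJ]]]]) simp
  have Gc: "continuous_on (closure A) G" unfolding G_def
    by (intro continuous_intros g(1) h(1) continuous_on_subset[OF cc]) simp
  have Gseg: "G x \<in> closed_segment (g x) (h x)" for x
    unfolding in_segment G_def using c(3)[of x] by (intro exI[of _ "c x"]) (simp add: algebra_simps)
  have inK: "x \<in> ?K" if "x \<in> A" "G x = z \<or> h x = z" for x
    using that Gseg[of x] closure_subset[of A] by auto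
  have GV: "G x = h x" if "x \<in> V" for x using c(6)[OF that] by (simp add: G_def)
  have jac: "jacobian G (at x) = jacobian h (at x)" if "x \<in> ?K" for x
  proof (rule jacobian_open_cong[of "V \<inter> A"])
    show "x \<in> V \<inter> A" using that c(5) KA by blast
    then show "h differentiable at x" using C1_with_differentiable[OF hH] by blast
    show "open (V \<inter> A)" using c(4) A(1) by blast
    show "h y = G y" if "y \<in> V \<inter> A" for y using GV that by simp
  qed
  have pre: "{x \<in> A. G x = z} = {x \<in> A. h x = z}"
  proof -
    have "G x = h x" if "x \<in> A" "G x = z \<or> h x = z" for x
      using inK[OF that] c(5) GV by blast
    then show ?thesis by (intro Collect_cong conj_cong refl) metis
  qed
  have jac': "jacobian G (at x) = jacobian h (at x)" if "x \<in> A" "h x = z" for x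
    using jac inK that by blast
  have Greg: "regular_value_on A G z"
    unfolding regular_value_on_def
  proof (intro ballI impI)
    fix x assume x: "x \<in> A" "G x = z"
    then have "h x = z" using pre by blast
    then show "det (jacobian G (at x)) \<noteq> 0"
      using h(3) x(1) jac'[OF x(1)] unfolding regular_value_on_def by simp
  qed
  have zg: "z \<notin> g ` frontier A" using seg ends_in_segment(1) by blast
  have zG: "z \<notin> G ` frontier A" using seg Gseg by blast
  have "regular_degree g A z = regular_degree G A z"
    by (rule regular_degree_eq_of_eq_near_frontier[OF A g zg Gc G1 Greg zG c(7,8)]) (simp add: G_def c(9))
  also have "\<dots> = regular_degree h A z"
    by (rule regular_degree_cong[OF pre jac'])
  finally show ?thesis .
qed

subsection \<open>Arbitrary finite index types\<close>

text \<open>The library proves the change of variables formula and Sard's theorem only for well-ordered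
  index types; \<open>'n idx\<close> is a well-ordered type with as many elements as \<open>'n\<close>.\<close>

typedef (overloaded) 'n idx = "{..<CARD('n::finite)}"
  by (rule exI[of _ 0]) simp

instantiation idx :: (finite) linorder
begin
definition less_eq_idx :: "'a idx \<Rightarrow> 'a idx \<Rightarrow> bool" where "x \<le> y \<longleftrightarrow> Rep_idx x \<le> Rep_idx y"
definition less_idx :: "'a idx \<Rightarrow> 'a idx \<Rightarrow> bool" where "x < y \<longleftrightarrow> Rep_idx x < Rep_idx y"
instance
  by standard (auto simp: less_eq_idx_def less_idx_def Rep_idx_inject)
end

instance idx :: (finite) wellorder
proof
  fix P :: "'a idx \<Rightarrow> bool" and a
  assume step: "\<And>x. (\<And>y. y < x \<Longrightarrow> P y) \<Longrightarrow> P x"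
  show "P a"
  proof (induction a rule: measure_induct_rule[of Rep_idx])
    case (less x)
    show ?case by (rule step) (simp add: less less_idx_def)
  qed
qed

lemma range_Rep_idx: "range (Rep_idx :: 'n::finite idx \<Rightarrow> nat) = {..<CARD('n)}"
  by (rule type_definition.Rep_range[OF type_definition_idx])

instance idx :: (finite) finite
proof
  have "finite (range (Rep_idx :: 'a idx \<Rightarrow> nat))" by (simp add: range_Rep_idx)
  then show "finite (UNIV :: 'a idx set)"
    by (rule finite_imageD) (auto simp: inj_on_def Rep_idx_inject)
qed

lemma ex_bij_idx: "\<exists>e :: 'n::finite idx \<Rightarrow> 'n. bij e"
proof -
  have "CARD('n idx) = card (range (Rep_idx :: 'n idx \<Rightarrow> nat))"
    by (rule card_image[symmetric]) (auto simp: inj_on_def Rep_idx_inject)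
  then have "CARD('n idx) = CARD('n)" by (simp add: range_Rep_idx)
  then show ?thesis by (intro finite_same_card_bij) auto
qed

section \<open>Signs and determinants under a renaming of indices\<close>

lemma sign_conj_bij:
  fixes e :: "'m::finite \<Rightarrow> 'n::finite"
  assumes "bij e" "p permutes UNIV"
  shows "sign (e \<circ> p \<circ> inv e) = sign p"
  using assms(2) finite_class.finite_UNIV
proof (induction rule: permutes_induct)
  case id
  have "e \<circ> id \<circ> inv e = id" using surj_iff[of e] bij_is_surj[OF assms(1)] by simp
  then show ?case by (simp add: sign_id)
next
  case (swap a b p)
  have i: "inv e (e x) = x" for x using assms(1) by (simp add: bij_is_inj)
  have s: "e (inv e y) = y" for y using assms(1) by (simp add: bij_is_surj surj_f_inv_f)
  have inj: "e x = e y \<longleftrightarrow> x = y" for x y using assms(1) by (simp add: bij_is_inj inj_eq)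
  \<comment> \<open>Conjugation by \<open>e\<close> carries a transposition to the transposition of
    the images, and it is multiplicative; this drives the induction.\<close>
  have t: "e \<circ> Transposition.transpose a b \<circ> inv e = Transposition.transpose (e a) (e b)"
  proof
    fix y
    obtain x where "y = e x" using s by metis
    then show "(e \<circ> Transposition.transpose a b \<circ> inv e) y = Transposition.transpose (e a) (e b) y"
      by (simp add: i Transposition.transpose_def inj)
  qed
  have perm: "permutation q" if "bij q" for q :: "'n \<Rightarrow> 'n"
    using that by (simp add: permutation)
  have bp: "bij p" using swap by (simp add: permutes_bij)
  have "e \<circ> (Transposition.transpose a b \<circ> p) \<circ> inv e = (e \<circ> Transposition.transpose a b \<circ> inv e) \<circ> (e \<circ> p \<circ> inv e)"
    by (simp add: fun_eq_iff i)
  then have "sign (e \<circ> (Transposition.transpose a b \<circ> p) \<circ> inv e) = sign (Transposition.transpose (e a) (e b)) * sign (e \<circ> p \<circ> inv e)"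
    unfolding t using assms(1) bp
    by (simp add: sign_compose perm bij_comp bij_imp_bij_inv)
  also have "\<dots> = sign (Transposition.transpose a b) * sign p"
    unfolding swap.IH sign_swap_id inj ..
  also have "\<dots> = sign (Transposition.transpose a b \<circ> p)"
    using bp by (simp add: sign_compose permutation)
  finally show ?case .
qed

text \<open>The Leibniz sum is reparametrized by conjugating permutations with \<open>e\<close>,
  which preserves their signs.\<close>

lemma det_reindex_bij:
  fixes e :: "'m::finite \<Rightarrow> 'n::finite" and J :: "real^'n^'n"
  assumes "bij e"
  shows "det (\<chi> i j. J $ e i $ e j) = det J"
proof -
  have i: "inv e (e x) = x" for x using assms(1) by (simp add: bij_is_inj)
  have s: "e (inv e y) = y" for y using assms(1) by (simp add: bij_is_surj surj_f_inv_f)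
  have "det J = (\<Sum>q\<in>{q. q permutes UNIV}. of_int (sign q) * (\<Prod>i\<in>UNIV. J $ i $ q i))"
    by (simp add: det_def)
  also have "\<dots> = (\<Sum>p\<in>{p. p permutes UNIV}. of_int (sign (e \<circ> p \<circ> inv e)) * (\<Prod>i\<in>UNIV. J $ i $ (e \<circ> p \<circ> inv e) i))"
  proof (rule sum.reindex_bij_witness[of _ "\<lambda>p. e \<circ> p \<circ> inv e" "\<lambda>q. inv e \<circ> q \<circ> e"])
    have b: "bij (inv e)" by (rule bij_imp_bij_inv[OF assms])
    show "inv e \<circ> q \<circ> e \<in> {p. p permutes UNIV}" if "q \<in> {q. q permutes UNIV}" for q
    proof -
      have "bij q" using that by (simp add: permutes_bij)
      then have "bij (inv e \<circ> q \<circ> e)" using assms b by (simp add: bij_comp o_assoc)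
      then show ?thesis by (auto intro: bij_imp_permutes)
    qed
    show "e \<circ> p \<circ> inv e \<in> {q. q permutes UNIV}" if "p \<in> {p. p permutes UNIV}" for p
    proof -
      have "bij p" using that by (simp add: permutes_bij)
      then have "bij (e \<circ> p \<circ> inv e)" using assms b by (simp add: bij_comp o_assoc)
      then show ?thesis by (auto intro: bij_imp_permutes)
    qed
    have rq: "e \<circ> (inv e \<circ> q \<circ> e) \<circ> inv e = q" for q by (simp add: fun_eq_iff s)
    show "e \<circ> (inv e \<circ> q \<circ> e) \<circ> inv e = q" for q by (rule rq)
    show "inv e \<circ> (e \<circ> p \<circ> inv e) \<circ> e = p" for p by (simp add: fun_eq_iff i)
    show "of_int (sign (e \<circ> (inv e \<circ> q \<circ> e) \<circ> inv e)) * (\<Prod>i\<in>UNIV. J $ i $ (e \<circ> (inv e \<circ> q \<circ> e) \<circ> inv e) i) =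
        of_int (sign q) * (\<Prod>i\<in>UNIV. J $ i $ q i)" for q
      unfolding rq ..
  qed
  also have "\<dots> = (\<Sum>p\<in>{p. p permutes UNIV}. of_int (sign p) * (\<Prod>i\<in>UNIV. J $ e i $ e (p i)))"
  proof (rule sum.cong[OF refl])
    fix p :: "'m \<Rightarrow> 'm" assume "p \<in> {p. p permutes UNIV}"
    moreover have "(\<Prod>i\<in>UNIV. J $ i $ (e \<circ> p \<circ> inv e) i) = (\<Prod>i\<in>UNIV. J $ e i $ e (p i))"
      using prod.reindex_bij_betw[OF assms, of "\<lambda>i. J $ i $ (e \<circ> p \<circ> inv e) i"] by (simp add: i)
    ultimately show "of_int (sign (e \<circ> p \<circ> inv e)) * (\<Prod>i\<in>UNIV. J $ i $ (e \<circ> p \<circ> inv e) i) = of_int (sign p) * (\<Prod>i\<in>UNIV. J $ e i $ e (p i))"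
      using sign_conj_bij[OF assms] by simp
  qed
  also have "\<dots> = det (\<chi> i j. J $ e i $ e j)" by (simp add: det_def)
  finally show ?thesis by simp
qed

text \<open>Contravariant in \<open>e\<close>: a bijection from \<open>'n idx\<close> to
  \<open>'n\<close> carries vectors indexed by \<open>'n\<close> to vectors indexed by
  \<open>'n idx\<close>. For bijective \<open>e\<close> the inverse is
  \<open>reindex (inv e)\<close>.\<close>

definition reindex :: "('m \<Rightarrow> 'n) \<Rightarrow> real^'n \<Rightarrow> real^'m" where
  "reindex e x = (\<chi> i. x $ e i)"

lemma linear_reindex: "linear (reindex e)"
  by (rule linearI) (simp_all add: reindex_def vec_eq_iff)

lemma bounded_linear_reindex:
  fixes e :: "'m::finite \<Rightarrow> 'n::finite"
  shows "bounded_linear (reindex e)"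
  using linear_reindex linear_conv_bounded_linear by blast

lemma continuous_on_reindex: 
  fixes e :: "'m::finite \<Rightarrow> 'n::finite"
  shows "continuous_on S (reindex e)"
  by (intro linear_continuous_on bounded_linear_reindex)

lemma reindex_inv:
  fixes e :: "'m::finite \<Rightarrow> 'n::finite"
  assumes "bij e"
  shows "reindex (inv e) (reindex e x) = x" "reindex e (reindex (inv e) y) = y"
  using assms by (simp_all add: reindex_def vec_eq_iff bij_is_inj bij_is_surj surj_f_inv_f)

definition conj_reindex :: "('m \<Rightarrow> 'n) \<Rightarrow> (real^'n \<Rightarrow> real^'n) \<Rightarrow> real^'m \<Rightarrow> real^'m" where
  "conj_reindex e g = (\<lambda>y. reindex e (g (reindex (inv e) y)))"

text \<open>The matrix of the linear map \<open>J\<close> conjugated by \<open>reindex e\<close>,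
  when \<open>e\<close> is bijective; see \<open>mat_reindex_mult\<close>.\<close>

definition mat_reindex :: "('m \<Rightarrow> 'n) \<Rightarrow> real^'n^'n \<Rightarrow> real^'m^'m" where
  "mat_reindex e J = (\<chi> i j. J $ e i $ e j)"

context
  fixes e :: "'m::finite \<Rightarrow> 'n::finite"
  assumes e: "bij e"
begin

lemma inj_reindex: "inj (reindex e :: real^'n \<Rightarrow> real^'m)"
  by (rule inj_on_inverseI[of _ "reindex (inv e)"]) (simp add: reindex_inv[OF e])

lemma reindex_image_eq: "reindex e ` A = {y. reindex (inv e) y \<in> A}"
proof
  show "reindex e ` A \<subseteq> {y. reindex (inv e) y \<in> A}" by (auto simp: reindex_inv[OF e])
  show "{y. reindex (inv e) y \<in> A} \<subseteq> reindex e ` A"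
    using reindex_inv(2)[OF e] by (metis (mono_tags, lifting) imageI mem_Collect_eq subsetI)
qed

lemma open_reindex_image: "open A \<Longrightarrow> open (reindex e ` A)"
  unfolding reindex_image_eq
  using open_vimage[of A "reindex (inv e)"] continuous_on_reindex[of UNIV "inv e"] by (simp add: vimage_def)

lemma frontier_reindex_image:
  assumes "open A" shows "frontier (reindex e ` A) = reindex e ` frontier A"
  using assms open_reindex_image[OF assms] inj_reindex
  by (simp add: frontier_def interior_open closure_injective_linear_image[OF linear_reindex inj_reindex, symmetric] image_set_diff)

lemma mat_reindex_mult: "reindex e (J *v reindex (inv e) v) = mat_reindex e J *v v"
proof -
  have "(\<Sum>j\<in>UNIV. J $ e i $ j * v $ inv e j) = (\<Sum>k\<in>UNIV. J $ e i $ e k * v $ k)" for i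
    using sum.reindex_bij_betw[OF e, of "\<lambda>j. J $ e i $ j * v $ inv e j"] e by (simp add: bij_is_inj)
  then show ?thesis by (simp add: vec_eq_iff reindex_def mat_reindex_def matrix_vector_mult_def)
qed

lemma C1_with_conj_reindex:
  assumes "C1_with A g J"
  shows "C1_with (reindex e ` A) (conj_reindex e g) (\<lambda>y. mat_reindex e (J (reindex (inv e) y)))"
  unfolding C1_with_def
proof safe
  fix x assume x: "x \<in> A"
  have "(g has_derivative (\<lambda>h. J x *v h)) (at (reindex (inv e) (reindex e x)))"
    using assms x by (simp add: C1_with_def reindex_inv[OF e])
  from diff_chain_at[OF bounded_linear_imp_has_derivative[OF bounded_linear_reindex] this]
  have "((\<lambda>y. g (reindex (inv e) y)) has_derivative (\<lambda>v. J x *v reindex (inv e) v)) (at (reindex e x))"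
    by (simp add: o_def)
  from diff_chain_at[OF this bounded_linear_imp_has_derivative[OF bounded_linear_reindex]]
  have "(conj_reindex e g has_derivative (\<lambda>v. reindex e (J x *v reindex (inv e) v))) (at (reindex e x))"
    by (simp add: o_def conj_reindex_def)
  then show "(conj_reindex e g has_derivative (\<lambda>v. mat_reindex e (J (reindex (inv e) (reindex e x))) *v v)) (at (reindex e x))"
    by (simp add: mat_reindex_mult reindex_inv[OF e])
next
  have "continuous_on (reindex e ` A) (\<lambda>y. J (reindex (inv e) y))"
    using assms by (intro continuous_on_compose2[OF _ continuous_on_reindex]) (auto simp: C1_with_def reindex_inv[OF e])
  then show "continuous_on (reindex e ` A) (\<lambda>y. mat_reindex e (J (reindex (inv e) y)))"
    unfolding mat_reindex_def by (intro continuous_on_matrix_entries) (auto intro!: continuous_intros)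
qed

lemma det_mat_reindex: "det (mat_reindex e J) = det J"
  unfolding mat_reindex_def by (rule det_reindex_bij[OF e])

lemma conj_reindex_reindex: "conj_reindex e g (reindex e x) = reindex e (g x)"
  by (simp add: conj_reindex_def reindex_inv[OF e])

lemma det_jacobian_conj_reindex:
  assumes "C1_map_on A g" "x \<in> A"
  shows "det (jacobian (conj_reindex e g) (at (reindex e x))) = det (jacobian g (at x))"
  using C1_with_jacobian[OF C1_with_conj_reindex[OF C1_map_on_with[THEN iffD1, OF assms(1)]], of "reindex e x"] assms(2)
  by (simp add: det_mat_reindex reindex_inv[OF e])

lemma reindex_eq_iff: "reindex e x = reindex e y \<longleftrightarrow> x = y"
  using inj_reindex by (simp add: inj_eq)

text \<open>\<open>reindex e\<close> matches the preimages one to one, and conjugation leaves the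
  Jacobian determinants unchanged.\<close>

lemma regular_degree_conj_reindex:
  assumes "C1_map_on A g"
  shows "regular_degree (conj_reindex e g) (reindex e ` A) (reindex e z) = regular_degree g A z"
proof -
  have "{y \<in> reindex e ` A. conj_reindex e g y = reindex e z} = reindex e ` {x \<in> A. g x = z}"
    by (auto simp: conj_reindex_reindex reindex_eq_iff)
  then have "regular_degree (conj_reindex e g) (reindex e ` A) (reindex e z) =
      (\<Sum>y\<in>reindex e ` {x \<in> A. g x = z}. sgn (det (jacobian (conj_reindex e g) (at y))))"
    by (simp add: regular_degree_def)
  also have "\<dots> = (\<Sum>x\<in>{x \<in> A. g x = z}. sgn (det (jacobian (conj_reindex e g) (at (reindex e x)))))"
    by (rule sum.reindex_cong[of "reindex e"]) (use inj_reindex in \<open>auto intro: inj_on_subset\<close>)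
  also have "\<dots> = regular_degree g A z"
    unfolding regular_degree_def by (rule sum.cong) (auto simp: det_jacobian_conj_reindex[OF assms])
  finally show ?thesis .
qed

lemma regular_value_on_conj_reindex:
  assumes "C1_map_on A g" "regular_value_on A g z"
  shows "regular_value_on (reindex e ` A) (conj_reindex e g) (reindex e z)"
  using assms(2) det_jacobian_conj_reindex[OF assms(1)] 
  by (auto simp: regular_value_on_def conj_reindex_reindex reindex_eq_iff)

lemma continuous_on_conj_reindex:
  assumes "continuous_on (closure A) g"
  shows "continuous_on (closure (reindex e ` A)) (conj_reindex e g)"
  unfolding closure_injective_linear_image[OF linear_reindex inj_reindex, symmetric] conj_reindex_def
  by (intro continuous_on_compose2[OF continuous_on_reindex] continuous_on_compose2[OF assms] continuous_on_reindex)
    (auto simp: reindex_inv[OF e])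

end

text \<open>All hypotheses are conjugated to the index type \<open>'n idx\<close>; being linear,
  \<open>reindex e\<close> maps segments onto segments.\<close>

lemma regular_degree_homotopy:
  fixes g h :: "real^'n \<Rightarrow> real^'n"
  assumes A: "open A" "bounded A"
    and g: "continuous_on (closure A) g" "C1_map_on A g" "regular_value_on A g z"
    and h: "continuous_on (closure A) h" "C1_map_on A h" "regular_value_on A h z"
    and seg: "\<And>x. x \<in> frontier A \<Longrightarrow> z \<notin> closed_segment (g x) (h x)"
  shows "regular_degree g A z = regular_degree h A z"
proof -
  obtain e :: "'n idx \<Rightarrow> 'n" where e: "bij e" using ex_bij_idx by blast
  let ?T = "reindex e"
  have "regular_degree (conj_reindex e g) (?T ` A) (?T z) = regular_degree (conj_reindex e h) (?T ` A) (?T z)"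
  proof (rule regular_degree_homotopy_wellorder)
    show "open (?T ` A)" by (rule open_reindex_image[OF e A(1)])
    show "bounded (?T ` A)" by (rule bounded_linear_image[OF A(2) bounded_linear_reindex])
    show "continuous_on (closure (?T ` A)) (conj_reindex e g)" "continuous_on (closure (?T ` A)) (conj_reindex e h)"
      using g(1) h(1) by (auto intro: continuous_on_conj_reindex[OF e])
    show "C1_map_on (?T ` A) (conj_reindex e g)" "C1_map_on (?T ` A) (conj_reindex e h)"
      using C1_with_imp[OF C1_with_conj_reindex[OF e]] g(2) h(2) C1_map_on_with by blast+
    show "regular_value_on (?T ` A) (conj_reindex e g) (?T z)" "regular_value_on (?T ` A) (conj_reindex e h) (?T z)"
      using g h by (auto intro: regular_value_on_conj_reindex[OF e])
    fix y assume "y \<in> frontier (?T ` A)"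
    then obtain x where x: "x \<in> frontier A" "y = ?T x" using frontier_reindex_image[OF e A(1)] by blast
    have "closed_segment (conj_reindex e g y) (conj_reindex e h y) = ?T ` closed_segment (g x) (h x)"
      unfolding x(2) conj_reindex_reindex[OF e] by (rule closed_segment_linear_image[OF linear_reindex])
    then show "?T z \<notin> closed_segment (conj_reindex e g y) (conj_reindex e h y)"
      using seg[OF x(1)] by (auto simp: reindex_eq_iff[OF e])
  qed
  then show ?thesis using regular_degree_conj_reindex[OF e] g(2) h(2) by metis
qed

section \<open>Sard's theorem and regular shifts\<close>

lemma negligible_critical_values_wellorder:
  fixes g :: "real^'m::{finite,wellorder} \<Rightarrow> real^'m::_"
  assumes "C1_with A g J"
  shows "negligible (g ` {x \<in> A. det (J x) = 0})"
proof (rule baby_Sard[where f' = "\<lambda>x h. J x *v h"])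
  fix x assume x: "x \<in> {x \<in> A. det (J x) = 0}"
  show "(g has_derivative (\<lambda>h. J x *v h)) (at x within {x \<in> A. det (J x) = 0})"
    using assms x by (auto simp: C1_with_def intro: has_derivative_at_withinI)
  show "rank (matrix (\<lambda>h. J x *v h)) < CARD('m)"
    using x by (simp add: det_eq_0_rank)
qed simp

lemma negligible_critical_values:
  fixes g :: "real^'n \<Rightarrow> real^'n"
  assumes "C1_with A g J"
  shows "negligible (g ` {x \<in> A. det (J x) = 0})"
proof -
  obtain e :: "'n idx \<Rightarrow> 'n" where e: "bij e" using ex_bij_idx by blast
  let ?T = "reindex e" and ?S = "reindex (inv e)"
  have "card (UNIV :: 'n idx set) = CARD('n)" by (rule bij_betw_same_card[OF e])
  then have dim: "DIM(real^'n idx) \<le> DIM(real^'n)" by simp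
  let ?Z = "{y \<in> ?T ` A. det (mat_reindex e (J (?S y))) = 0}"
  have "negligible (conj_reindex e g ` ?Z)"
    by (rule negligible_critical_values_wellorder[OF C1_with_conj_reindex[OF e assms]])
  then have "negligible (?S ` (conj_reindex e g ` ?Z))"
    by (intro negligible_differentiable_image_negligible[OF dim])
      (auto intro: linear_imp_differentiable_on linear_reindex)
  moreover have "g ` {x \<in> A. det (J x) = 0} \<subseteq> ?S ` (conj_reindex e g ` ?Z)"
  proof
    fix w assume "w \<in> g ` {x \<in> A. det (J x) = 0}"
    then obtain x where x: "x \<in> A" "det (J x) = 0" "w = g x" by blast
    then have "?T x \<in> ?Z" by (simp add: det_mat_reindex[OF e] reindex_inv[OF e])
    moreover have "w = ?S (conj_reindex e g (?T x))" by (simp add: x(3) conj_reindex_reindex[OF e] reindex_inv[OF e])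
    ultimately show "w \<in> ?S ` (conj_reindex e g ` ?Z)" by blast
  qed
  ultimately show ?thesis by (rule negligible_subset)
qed

text \<open>For each \<open>p\<close> the shifts \<open>c\<close> that make \<open>p + c\<close> a
  critical value form a null set, and finitely many null sets do not cover a ball.\<close>

lemma ex_regular_shift:
  fixes g :: "real^'n \<Rightarrow> real^'n"
  assumes "C1_map_on A g" "finite P" "r > 0"
  obtains c where "norm c < r" "\<And>p. p \<in> P \<Longrightarrow> regular_value_on A g (p + c)"
proof -
  let ?N = "g ` {x \<in> A. det (jacobian g (at x)) = 0}"
  have N: "negligible ?N" using negligible_critical_values C1_map_on_with assms(1) by blast
  have "negligible (\<Union>p\<in>P. (+) (- p) ` ?N)"
  proof (rule negligible_Union)
    show "finite ((\<lambda>p. (+) (- p) ` ?N) ` P)" using assms(2) by simp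
    show "negligible t" if "t \<in> (\<lambda>p. (+) (- p) ` ?N) ` P" for t
      using that negligible_translation[OF N] by blast
  qed
  moreover have "\<not> negligible (ball (0::real^'n) r)"
    using assms(3) open_not_negligible[of "ball (0::real^'n) r"] by simp
  ultimately have "\<not> ball 0 r \<subseteq> (\<Union>p\<in>P. (+) (- p) ` ?N)" using negligible_subset by blast
  then obtain c where c: "c \<in> ball 0 r" "c \<notin> (\<Union>p\<in>P. (+) (- p) ` ?N)" by blast
  show ?thesis
  proof (rule that[of c])
    show "norm c < r" using c(1) by simp
    fix p assume p: "p \<in> P"
    show "regular_value_on A g (p + c)"
      unfolding regular_value_on_def
    proof (intro ballI impI notI)
      fix x assume x: "x \<in> A" "g x = p + c" "det (jacobian g (at x)) = 0"
      then have "c = - p + g x" by simp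
      then have "c \<in> (+) (- p) ` ?N" using x by blast
      then show False using c(2) p by blast
    qed
  qed
qed

subsection \<open>Properties of the Brouwer degree\<close>

lemma closed_segment_subset_ball:
  fixes a b w :: "'a::real_normed_vector"
  shows "a \<in> ball w r \<Longrightarrow> b \<in> ball w r \<Longrightarrow> closed_segment a b \<subseteq> ball w r"
  by (rule closed_segment_subset) (assumption | rule convex_ball)+

text \<open>For nonempty bounded \<open>A\<close> the frontier is nonempty. This matters because
  \<open>infdist\<close> to the empty set is 0 by convention.\<close>

lemma infdist_frontier_pos:
  fixes y :: "'a::euclidean_space \<Rightarrow> 'b::euclidean_space"
  assumes "bounded A" "continuous_on (closure A) y" "z \<notin> y ` frontier A" "A \<noteq> {}"
  shows "0 < infdist z (y ` frontier A)"
proof -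
  have "compact (frontier A)" using assms(1) by (rule compact_frontier_bounded)
  then have "compact (y ` frontier A)"
    by (intro compact_continuous_image continuous_on_subset[OF assms(2)]) (auto simp: frontier_def)
  moreover have "frontier A \<noteq> {}" using assms(1,4) by (auto simp: frontier_eq_empty)
  ultimately show ?thesis
    using infdist_pos_not_in_closed[of "y ` frontier A" z] assms(3) compact_imp_closed by blast
qed

text \<open>A polynomial within \<open>r / 2\<close> of \<open>f\<close> is shifted by a constant of
  norm below \<open>r / 2\<close>, chosen by Sard's theorem. Treating a finite set \<open>P\<close>
  at once serves the product formula, where one map must be regular at several points.\<close>

lemma approximation_with_regular_values:
  fixes f :: "real^'n \<Rightarrow> real^'n"
  assumes "compact S" "continuous_on S f" "finite P" "r > 0"
  obtains g where "C1_map_on UNIV g" "\<And>x. x \<in> S \<Longrightarrow> dist (g x) (f x) < r" "\<And>p. p \<in> P \<Longrightarrow> regular_value_on UNIV g p"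
proof -
  have r2: "0 < r / 2" using assms(4) by simp
  obtain p where p: "polynomial_function p" "\<And>x. x \<in> S \<Longrightarrow> norm (f x - p x) < r / 2"
    using Stone_Weierstrass_polynomial_function[OF assms(1,2) r2] by blast
  obtain J where J: "C1_with UNIV p J" using polynomial_function_C1[OF p(1)] by blast
  obtain c where c: "norm c < r / 2" "\<And>q. q \<in> P \<Longrightarrow> regular_value_on UNIV p (q + c)"
    by (rule ex_regular_shift[OF C1_with_imp[OF J] assms(3) r2]) (rule that; blast)
  have J': "C1_with UNIV (\<lambda>x. p x - c) J"
    using C1_with_diff[OF J C1_with_const[of UNIV c]] by simp
  show ?thesis
  proof (rule that[of "\<lambda>x. p x - c"])
    show "C1_map_on UNIV (\<lambda>x. p x - c)" by (rule C1_with_imp[OF J'])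
    show "dist (p x - c) (f x) < r" if "x \<in> S" for x
    proof -
      have "p x - c - f x = - (f x - p x) - c" by simp
      then have "norm (p x - c - f x) \<le> norm (f x - p x) + norm c" using norm_triangle_ineq4[of "- (f x - p x)" c] by (simp only: norm_minus_cancel)
      then show ?thesis using p(2)[OF that] c(1) unfolding dist_norm by linarith
    qed
    show "regular_value_on UNIV (\<lambda>x. p x - c) q" if "q \<in> P" for q
      using c(2)[OF that] C1_with_jacobian[OF J] C1_with_jacobian[OF J'] by (simp add: regular_value_on_def diff_eq_eq)
  qed
qed

lemma C1_map_on_subset: "C1_map_on A g \<Longrightarrow> B \<subseteq> A \<Longrightarrow> C1_map_on B g"
  using C1_map_on_with C1_with_subset C1_with_imp by blast

lemma C1_map_on_continuous_on: "C1_map_on A g \<Longrightarrow> continuous_on A g"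
  using C1_map_on_with C1_with_continuous_on by blast

lemma degree_approximant_exists:
  fixes y :: "real^'n \<Rightarrow> real^'n"
  assumes "open A" "bounded A" "continuous_on (closure A) y" "z \<notin> y ` frontier A" "r > 0"
  obtains g where "degree_approximant y A z g" "\<And>x. x \<in> closure A \<Longrightarrow> dist (g x) (y x) < r" "C1_map_on UNIV g" "regular_value_on UNIV g z"
proof -
  \<comment> \<open>For empty \<open>A\<close> the \<open>infdist\<close> is 0, but the estimate on
    \<open>closure A\<close> is vacuous and \<open>r\<close> itself serves.\<close>
  let ?r = "if A = {} then r else min r (infdist z (y ` frontier A))"
  have "?r > 0" using infdist_frontier_pos[OF assms(2-4)] assms(5) by auto
  moreover have "compact (closure A)" using assms(2) by (simp add: compact_closure)
  ultimately obtain g where g: "C1_map_on UNIV g" "\<And>x. x \<in> closure A \<Longrightarrow> dist (g x) (y x) < ?r" "\<And>p. p \<in> {z} \<Longrightarrow> regular_value_on UNIV g p"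
    using approximation_with_regular_values[of "closure A" y "{z}" ?r thesis] assms(3) by blast
  have d: "dist (g x) (y x) < r" "dist (g x) (y x) < infdist z (y ` frontier A)" if "x \<in> closure A" for x
    using g(2)[OF that] that by (auto split: if_splits)
  show ?thesis
  proof (rule that[of g])
    show "degree_approximant y A z g"
      unfolding degree_approximant_def
      using g d C1_map_on_subset[OF g(1)] continuous_on_subset[OF C1_map_on_continuous_on[OF g(1)]]
      by (auto simp: regular_value_on_def)
  qed (use g d in auto)
qed

text \<open>On the frontier \<open>g x\<close> and \<open>h x\<close> lie in a ball about
  \<open>y x\<close> that does not contain \<open>z\<close>; by convexity the segment between them
  misses \<open>z\<close>.\<close>

lemma degree_approximant_regular_degree_unique:
  fixes y :: "real^'n \<Rightarrow> real^'n"
  assumes "open A" "bounded A" "degree_approximant y A z g" "degree_approximant y A z h"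
  shows "regular_degree g A z = regular_degree h A z"
proof (rule regular_degree_homotopy[OF assms(1,2)])
  fix x assume x: "x \<in> frontier A"
  let ?r = "infdist z (y ` frontier A)"
  have "x \<in> closure A" using x by (simp add: frontier_def)
  then have "g x \<in> ball (y x) ?r" "h x \<in> ball (y x) ?r"
    using assms(3,4) by (auto simp: degree_approximant_def dist_commute)
  then have "closed_segment (g x) (h x) \<subseteq> ball (y x) ?r" by (rule closed_segment_subset_ball)
  moreover have "?r \<le> dist z (y x)" using x by (simp add: infdist_le)
  ultimately show "z \<notin> closed_segment (g x) (h x)" by (auto simp: dist_commute)
qed (use assms(3,4) in \<open>auto simp: degree_approximant_def\<close>)

lemma regular_degree_Ints: "regular_degree g A z \<in> \<int>"
  unfolding regular_degree_def by (intro Ints_sum) (simp add: sgn_if)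

text \<open>The regular degree is an integer and independent of the approximant, so the definite
  description in \<open>brouwer_deg\<close> has a unique witness.\<close>

lemma brouwer_deg_eq_regular_degree:
  fixes y :: "real^'n \<Rightarrow> real^'n"
  assumes "open A" "bounded A" "degree_approximant y A z g"
  shows "real_of_int (brouwer_deg y A z) = regular_degree g A z"
proof -
  obtain n where n: "regular_degree g A z = of_int n" using regular_degree_Ints Ints_cases by metis
  have "brouwer_deg y A z = n"
    unfolding brouwer_deg_def
  proof (rule the_equality)
    show "\<exists>g. degree_approximant y A z g \<and> real_of_int n = regular_degree g A z" using assms(3) n by metis
    fix m assume "\<exists>g. degree_approximant y A z g \<and> real_of_int m = regular_degree g A z"
    then obtain h where "degree_approximant y A z h" "real_of_int m = regular_degree h A z" by blast
    then show "m = n" using degree_approximant_regular_degree_unique[OF assms(1,2,3), of h] n by simp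
  qed
  then show ?thesis using n by simp
qed

text \<open>The union of the segments over \<open>S\<close> is compact and thus has a positive
  distance \<open>d\<close> from \<open>z\<close>. Moving both endpoints by less than
  \<open>d\<close> moves each convex combination by less than \<open>d\<close>.\<close>

lemma segment_gap:
  fixes f g :: "'a::metric_space \<Rightarrow> 'b::real_normed_vector"
  assumes "compact S" "continuous_on S f" "continuous_on S g" "\<And>x. x \<in> S \<Longrightarrow> z \<notin> closed_segment (f x) (g x)"
  obtains d where "d > 0" "\<And>x a b. x \<in> S \<Longrightarrow> dist a (f x) < d \<Longrightarrow> dist b (g x) < d \<Longrightarrow> z \<notin> closed_segment a b"
proof -
  let ?f = "\<lambda>p. (1 - fst p) *\<^sub>R f (snd p) + fst p *\<^sub>R g (snd p)"
  let ?T = "{0..1::real} \<times> S"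
  have c: "continuous_on ?T ?f"
    by (intro continuous_intros continuous_on_compose2[OF assms(2)] continuous_on_compose2[OF assms(3)]) auto
  have "compact ?T" by (intro compact_Times assms(1)) simp
  then have cl: "closed (?f ` ?T)" by (intro compact_imp_closed compact_continuous_image c)
  have "z \<notin> ?f ` ?T"
  proof
    assume "z \<in> ?f ` ?T"
    then obtain t x where "t \<in> {0..1}" "x \<in> S" "z = (1 - t) *\<^sub>R f x + t *\<^sub>R g x" by auto
    then show False using assms(4)[of x] by (auto simp: in_segment)
  qed
  then obtain d where d: "d > 0" "\<And>w. dist z w < d \<Longrightarrow> w \<notin> ?f ` ?T"
  proof -
    have "z \<in> - (?f ` ?T)" using \<open>z \<notin> ?f ` ?T\<close> by (rule Compl_iff[THEN iffD2])
    with open_Compl[OF cl] obtain d where d: "0 < d" "ball z d \<subseteq> - (?f ` ?T)" by (rule openE)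
    show thesis
    proof (rule that[OF d(1)])
      fix w assume "dist z w < d"
      then show "w \<notin> ?f ` ?T" using d(2) by (meson ComplD mem_ball subsetD)
    qed
  qed
  show ?thesis
  proof (rule that[OF d(1)])
    fix x a b assume x: "x \<in> S" and a: "dist a (f x) < d" and b: "dist b (g x) < d"
    show "z \<notin> closed_segment a b"
    proof
      assume "z \<in> closed_segment a b"
      then obtain t where t: "0 \<le> t" "t \<le> 1" "z = (1 - t) *\<^sub>R a + t *\<^sub>R b" by (auto simp: in_segment)
      let ?w = "(1 - t) *\<^sub>R f x + t *\<^sub>R g x"
      have "z - ?w = (1 - t) *\<^sub>R (a - f x) + t *\<^sub>R (b - g x)" by (simp add: t(3) algebra_simps)
      then have "dist z ?w \<le> (1 - t) * dist a (f x) + t * dist b (g x)"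
        using norm_triangle_ineq[of "(1 - t) *\<^sub>R (a - f x)" "t *\<^sub>R (b - g x)"] t by (simp add: dist_norm)
      also have "\<dots> < d" using t convex_bound_lt[OF a b, of "1 - t" t] by simp
      finally have "?w \<notin> ?f ` ?T" by (rule d(2))
      moreover have "?w = ?f (t, x)" "(t, x) \<in> ?T" using t x by auto
      ultimately show False by blast
    qed
  qed
qed

text \<open>Approximants closer to \<open>y\<close> and \<open>w\<close> than the segment gap still
  have segments avoiding \<open>z\<close> on the frontier, so homotopy invariance of the regular
  degree applies to them.\<close>

lemma brouwer_deg_homotopy:
  fixes y w :: "real^'n \<Rightarrow> real^'n"
  assumes A: "open A" "bounded A" and y: "continuous_on (closure A) y" and w: "continuous_on (closure A) w"
    and seg: "\<And>x. x \<in> frontier A \<Longrightarrow> z \<notin> closed_segment (y x) (w x)"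
  shows "brouwer_deg y A z = brouwer_deg w A z"
proof -
  have sub: "frontier A \<subseteq> closure A" by (auto simp: frontier_def)
  obtain d where d: "d > 0" "\<And>x a b. x \<in> frontier A \<Longrightarrow> dist a (y x) < d \<Longrightarrow> dist b (w x) < d \<Longrightarrow> z \<notin> closed_segment a b"
    by (rule segment_gap[OF compact_frontier_bounded[OF A(2)] continuous_on_subset[OF y sub] continuous_on_subset[OF w sub] seg]) (assumption, rule that, assumption, blast)
  have zy: "z \<notin> y ` frontier A" and zw: "z \<notin> w ` frontier A" using seg by auto
  obtain g where g: "degree_approximant y A z g" "\<And>x. x \<in> closure A \<Longrightarrow> dist (g x) (y x) < d"
    by (rule degree_approximant_exists[OF A y zy d(1)]) (rule that; blast)
  obtain h where h: "degree_approximant w A z h" "\<And>x. x \<in> closure A \<Longrightarrow> dist (h x) (w x) < d"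
    by (rule degree_approximant_exists[OF A w zw d(1)]) (rule that; blast)
  have "regular_degree g A z = regular_degree h A z"
  proof (rule regular_degree_homotopy[OF A])
    show "z \<notin> closed_segment (g x) (h x)" if "x \<in> frontier A" for x
      using d(2)[OF that] g(2) h(2) that sub by blast
  qed (use g(1) h(1) in \<open>auto simp: degree_approximant_def\<close>)
  then show ?thesis
    using brouwer_deg_eq_regular_degree[OF A g(1)] brouwer_deg_eq_regular_degree[OF A h(1)] by simp
qed

lemma brouwer_deg_boundary_cong:
  fixes y w :: "real^'n \<Rightarrow> real^'n"
  assumes "open A" "bounded A" "continuous_on (closure A) y" "continuous_on (closure A) w"
    "\<And>x. x \<in> frontier A \<Longrightarrow> y x = w x" "z \<notin> y ` frontier A"
  shows "brouwer_deg y A z = brouwer_deg w A z"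
  by (rule brouwer_deg_homotopy[OF assms(1-4)]) (use assms(5,6) in auto)

lemma brouwer_deg_translation:
  fixes y :: "real^'n \<Rightarrow> real^'n"
  assumes A: "open A" "bounded A" and y: "continuous_on (closure A) y" and z: "z + c \<notin> y ` frontier A"
  shows "brouwer_deg (\<lambda>x. y x - c) A z = brouwer_deg y A (z + c)"
proof (cases "A = {}")
  case True
  then have "degree_approximant v A u (\<lambda>x. 0)" for u :: "real^'n" and v
    by (simp add: degree_approximant_def C1_map_on_def regular_value_on_def)
  then have "real_of_int (brouwer_deg v A u) = 0" for u :: "real^'n" and v
    using brouwer_deg_eq_regular_degree[OF A] True by (metis (no_types, lifting) regular_degree_def empty_Collect_eq empty_iff sum.empty)
  then show ?thesis by simp
next
  case False
  have yc: "continuous_on (closure A) (\<lambda>x. y x - c)" by (intro continuous_intros y)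
  have zc: "z \<notin> (\<lambda>x. y x - c) ` frontier A" using z by auto
  \<comment> \<open>The extra bound uses the distance for the shifted map, so that \<open>g\<close>
    minus \<open>c\<close> is directly an approximant of that map at \<open>z\<close>.\<close>
  obtain g where g: "degree_approximant y A (z + c) g" "\<And>x. x \<in> closure A \<Longrightarrow> dist (g x) (y x) < infdist z ((\<lambda>x. y x - c) ` frontier A)"
    by (rule degree_approximant_exists[OF A y z infdist_frontier_pos[OF A(2) yc zc False]]) (rule that; blast)
  obtain J where J: "C1_with A g J" using g(1) C1_map_on_with by (auto simp: degree_approximant_def)
  have J': "C1_with A (\<lambda>x. g x - c) J"
    using C1_with_diff[OF J C1_with_const[of A c]] by simp
  have jac: "jacobian (\<lambda>x. g x - c) (at x) = jacobian g (at x)" if "x \<in> A" for x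
    using C1_with_jacobian[OF J that] C1_with_jacobian[OF J' that] by simp
  have "degree_approximant (\<lambda>x. y x - c) A z (\<lambda>x. g x - c)"
    unfolding degree_approximant_def
  proof (intro conjI ballI)
    show "continuous_on (closure A) (\<lambda>x. g x - c)" using g(1) by (auto simp: degree_approximant_def intro!: continuous_intros)
    show "C1_map_on A (\<lambda>x. g x - c)" by (rule C1_with_imp[OF J'])
    show "regular_value_on A (\<lambda>x. g x - c) z"
      using g(1) jac by (auto simp: degree_approximant_def regular_value_on_def)
    show "dist (g x - c) (y x - c) < infdist z ((\<lambda>x. y x - c) ` frontier A)" if "x \<in> closure A" for x
      using g(2)[OF that] by (simp add: dist_norm)
  qed
  from brouwer_deg_eq_regular_degree[OF A this] brouwer_deg_eq_regular_degree[OF A g(1)]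
  have "real_of_int (brouwer_deg (\<lambda>x. y x - c) A z) = regular_degree (\<lambda>x. g x - c) A z"
    "real_of_int (brouwer_deg y A (z + c)) = regular_degree g A (z + c)" .
  moreover have "regular_degree (\<lambda>x. g x - c) A z = regular_degree g A (z + c)"
    unfolding regular_degree_def by (rule sum.cong) (auto simp: jac diff_eq_eq)
  ultimately show ?thesis by simp
qed

text \<open>Replacing \<open>z\<close> by \<open>z'\<close> amounts to translating \<open>y\<close>
  by \<open>z - z'\<close>. During this translation \<open>y x\<close> stays closer to its original
  position than \<open>z\<close> is.\<close>

lemma brouwer_deg_near:
  fixes y :: "real^'n \<Rightarrow> real^'n"
  assumes A: "open A" "bounded A" and y: "continuous_on (closure A) y" and z: "z \<notin> y ` frontier A"
    and near: "\<And>x. x \<in> frontier A \<Longrightarrow> dist z z' < dist z (y x)"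
  shows "brouwer_deg y A z' = brouwer_deg y A z"
proof -
  let ?c = "z' - z"
  have "z + ?c \<notin> y ` frontier A"
  proof
    assume "z + ?c \<in> y ` frontier A"
    then obtain x where "x \<in> frontier A" "y x = z'" by auto
    with near show False by force
  qed
  then have "brouwer_deg y A z' = brouwer_deg (\<lambda>x. y x - ?c) A z"
    using brouwer_deg_translation[OF A y, of z ?c] by simp
  also have "\<dots> = brouwer_deg y A z"
  proof (rule brouwer_deg_homotopy[OF A _ y])
    show "continuous_on (closure A) (\<lambda>x. y x - ?c)" by (intro continuous_intros y)
    fix x assume x: "x \<in> frontier A"
    let ?r = "dist z (y x)"
    have "y x - ?c \<in> ball (y x) ?r" "y x \<in> ball (y x) ?r"
      using near[OF x] by (auto simp: dist_norm norm_minus_commute intro: le_less_trans[OF norm_ge_zero])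
    then have "closed_segment (y x - ?c) (y x) \<subseteq> ball (y x) ?r" by (rule closed_segment_subset_ball)
    then show "z \<notin> closed_segment (y x - ?c) (y x)" by (auto simp: dist_commute)
  qed
  finally show ?thesis .
qed

lemma compact_image_frontier:
  fixes y :: "'a::euclidean_space \<Rightarrow> 'b::euclidean_space"
  assumes "bounded A" "continuous_on (closure A) y"
  shows "compact (y ` frontier A)"
  by (intro compact_continuous_image continuous_on_subset[OF assms(2)] compact_frontier_bounded[OF assms(1)]) (auto simp: frontier_def)

lemma brouwer_deg_locally_constant:
  fixes y :: "real^'n \<Rightarrow> real^'n"
  assumes A: "open A" "bounded A" and y: "continuous_on (closure A) y" and z: "z \<notin> y ` frontier A"
  obtains r where "r > 0" "\<And>z'. dist z z' < r \<Longrightarrow> z' \<notin> y ` frontier A \<and> brouwer_deg y A z' = brouwer_deg y A z"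
proof -
  obtain r where r: "r > 0" "\<forall>w\<in>y ` frontier A. r \<le> dist z w"
    using separate_point_closed[OF compact_imp_closed[OF compact_image_frontier[OF A(2) y]] z] by blast
  show ?thesis
  proof (rule that[OF r(1)], intro conjI)
    fix z' assume d: "dist z z' < r"
    show "z' \<notin> y ` frontier A" using r(2) d by auto
    show "brouwer_deg y A z' = brouwer_deg y A z"
      by (rule brouwer_deg_near[OF A y z]) (use r(2) d in force)
  qed
qed

lemma brouwer_deg_connected_const:
  fixes y :: "real^'n \<Rightarrow> real^'n"
  assumes A: "open A" "bounded A" and y: "continuous_on (closure A) y"
    and C: "connected C" "C \<inter> y ` frontier A = {}" "a \<in> C" "b \<in> C"
  shows "brouwer_deg y A a = brouwer_deg y A b"
proof (rule connected_local_const[OF C(1,3,4)], rule ballI)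
  fix c assume "c \<in> C"
  then have "c \<notin> y ` frontier A" using C(2) by blast
  then obtain r where r: "r > 0" "\<And>z'. dist c z' < r \<Longrightarrow> z' \<notin> y ` frontier A \<and> brouwer_deg y A z' = brouwer_deg y A c"
    by (rule brouwer_deg_locally_constant[OF A y]) (rule that; blast)
  show "\<forall>\<^sub>F b in at c within C. brouwer_deg y A c = brouwer_deg y A b"
    unfolding eventually_at
  proof (intro exI[of _ r] conjI ballI impI)
    show "brouwer_deg y A c = brouwer_deg y A x" if "x \<noteq> c \<and> dist x c < r" for x
      using r(2)[of x] that by (simp add: dist_commute)
  qed (rule r(1))
qed

text \<open>A sufficiently close approximant also misses \<open>z\<close>, so its regular degree is
  an empty sum.\<close>

lemma brouwer_deg_eq_0_outside_image:
  fixes y :: "real^'n \<Rightarrow> real^'n"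
  assumes A: "open A" "bounded A" and y: "continuous_on (closure A) y" and z: "z \<notin> y ` closure A"
  shows "brouwer_deg y A z = 0"
proof -
  have zf: "z \<notin> y ` frontier A" using z by (auto simp: frontier_def)
  have "compact (y ` closure A)" using A(2) y by (simp add: compact_closure compact_continuous_image)
  then obtain r where r: "r > 0" "\<forall>w\<in>y ` closure A. r \<le> dist z w"
    using separate_point_closed[OF compact_imp_closed z] by blast
  obtain g where g: "degree_approximant y A z g" "\<And>x. x \<in> closure A \<Longrightarrow> dist (g x) (y x) < r"
    by (rule degree_approximant_exists[OF A y zf r(1)]) (rule that; blast)
  have "g x \<noteq> z" if "x \<in> A" for x
    using g(2)[of x] r(2) closure_subset that by fastforce
  then have "regular_degree g A z = 0" unfolding regular_degree_def by (intro sum.neutral) auto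
  then show ?thesis using brouwer_deg_eq_regular_degree[OF A g(1)] by simp
qed

text \<open>The unbounded set \<open>C\<close> contains a point outside the compact image of
  \<open>closure A\<close>, and the degree is constant on \<open>C\<close>.\<close>

lemma brouwer_deg_eq_0_unbounded:
  fixes y :: "real^'n \<Rightarrow> real^'n"
  assumes A: "open A" "bounded A" and y: "continuous_on (closure A) y"
    and C: "connected C" "C \<inter> y ` frontier A = {}" "\<not> bounded C" "z \<in> C"
  shows "brouwer_deg y A z = 0"
proof -
  have "compact (y ` closure A)" using A(2) y by (simp add: compact_closure compact_continuous_image)
  then have "\<not> C \<subseteq> y ` closure A" using C(3) bounded_subset compact_imp_bounded by blast
  then obtain c where "c \<in> C" "c \<notin> y ` closure A" by blast
  then show ?thesis
    using brouwer_deg_connected_const[OF A y C(1,2,4), of c] brouwer_deg_eq_0_outside_image[OF A y] by simp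
qed

lemma brouwer_deg_id:
  fixes A :: "(real^'n) set"
  assumes A: "open A" "bounded A" and z: "z \<notin> frontier A"
  shows "brouwer_deg (\<lambda>x. x) A z = (if z \<in> A then 1 else 0)"
proof (cases "z \<in> A")
  case True
  have jac: "jacobian (\<lambda>x. x) (at x) = (mat 1 :: real^'n^'n)" for x
    using C1_with_jacobian[OF C1_with_id] by blast
  have "degree_approximant (\<lambda>x. x) A z (\<lambda>x. x)"
    unfolding degree_approximant_def
    using C1_with_imp[OF C1_with_id] infdist_frontier_pos[of A "\<lambda>x. x" z] A z True
    by (auto simp: regular_value_on_def jac)
  then have "real_of_int (brouwer_deg (\<lambda>x. x) A z) = regular_degree (\<lambda>x. x) A z"
    by (rule brouwer_deg_eq_regular_degree[OF A])
  also have "\<dots> = 1"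
  proof -
    have "{x. x \<in> A \<and> x = z} = {z}" using True by auto
    then show ?thesis by (simp add: regular_degree_def jac)
  qed
  finally show ?thesis using True by simp
next
  case False
  then show ?thesis
    using brouwer_deg_eq_0_outside_image[OF A, of "\<lambda>x. x" z] z by (auto simp: frontier_def interior_open A(1))
qed

text \<open>Leray's product formula; the preimages of \<open>q\<close> outside \<open>W\<close> contribute nothing because \<open>\<psi>\<close> has
  degree 0 on the unbounded exterior of \<open>W\<close>.\<close>

lemma brouwer_deg_compose:
  fixes f \<psi> :: "real^'n \<Rightarrow> real^'n"
  assumes W: "open W" "bounded W" "connected W" "connected (- closure W)" "p0 \<in> W"
    and D: "open D" "bounded D"
    and f: "continuous_on UNIV f" and \<psi>: "continuous_on UNIV \<psi>" "\<psi> ` frontier D \<subseteq> frontier W"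
    and q: "q \<notin> f ` frontier W"
  shows "brouwer_deg (\<lambda>x. f (\<psi> x)) D q = brouwer_deg \<psi> D p0 * brouwer_deg f W q"
proof (cases "D = {}")
  case True
  have "brouwer_deg v D u = 0" for v and u :: "real^'n"
    using brouwer_deg_eq_0_outside_image[OF D, of v u] True by simp
  then show ?thesis by simp
next
  case False
  let ?F = "frontier W"
  have fW: "continuous_on (closure W) f" and \<psi>D: "continuous_on (closure D) \<psi>" and f\<psi>: "continuous_on (closure D) (\<lambda>x. f (\<psi> x))"
    using f \<psi>(1) continuous_on_compose2[OF f \<psi>(1)] by (auto intro: continuous_on_subset)
  have Wne: "W \<noteq> {}" using W(5) by blast
  have q\<psi>: "q \<notin> (\<lambda>x. f (\<psi> x)) ` frontier D" using q \<psi>(2) by blast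
  \<comment> \<open>The minimum allows \<open>g\<close> to approximate \<open>f\<close> on
    \<open>W\<close> and the composition of \<open>g\<close> and \<open>h\<close> to approximate
    that of \<open>f\<close> and \<open>\<psi>\<close> on \<open>D\<close>. In the composition
    \<open>g\<close> and \<open>h\<close> each cause an error below
    \<open>\<delta> / 2\<close>.\<close>
  define \<delta> where "\<delta> = min (infdist q (f ` ?F)) (infdist q ((\<lambda>x. f (\<psi> x)) ` frontier D))"
  have \<delta>: "\<delta> > 0"
    using infdist_frontier_pos[OF W(2) fW q Wne] infdist_frontier_pos[OF D(2) f\<psi> q\<psi> False] by (simp add: \<delta>_def)
  have "compact (\<psi> ` closure D)" using D(2) \<psi>D by (simp add: compact_closure compact_continuous_image)
  then have "bounded (\<psi> ` closure D \<union> closure W)" using W(2) by (simp add: compact_imp_bounded)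
  then obtain R where R: "\<And>x. x \<in> \<psi> ` closure D \<union> closure W \<Longrightarrow> norm x \<le> R" unfolding bounded_iff by blast
  \<comment> \<open>The margin 1 keeps the values of \<open>h\<close>, which is less than 1 away
    from \<open>\<psi>\<close>, in the ball where \<open>g\<close> is controlled.\<close>
  let ?B = "cball (0::real^'n) (R + 1)"
  obtain g where g: "C1_map_on UNIV g" "\<And>x. x \<in> ?B \<Longrightarrow> dist (g x) (f x) < \<delta> / 2" "\<And>p. p \<in> {q} \<Longrightarrow> regular_value_on UNIV g p"
    using approximation_with_regular_values[OF compact_cball continuous_on_subset[OF f], of 0 "R + 1" "{q}" "\<delta> / 2" thesis] \<delta> by auto
  have gq: "regular_value_on UNIV g q" using g(3) by blast
  have gc: "continuous_on S g" for S using C1_map_on_continuous_on[OF g(1)] continuous_on_subset by blast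
  \<comment> \<open>\<open>P\<close> also contains the preimages of \<open>q\<close> outside
    \<open>W\<close>, since \<open>h\<close> may reach them.\<close>
  define P where "P = {x \<in> ?B. g x = q}"
  have "finite P"
    unfolding P_def by (rule finite_regular_preimage_compact[OF open_UNIV g(1) gq compact_cball]) simp
  have WB: "closure W \<subseteq> ?B" using R by force
  have FB: "?F \<subseteq> ?B" using WB by (auto simp: frontier_def)
  have PF: "p \<notin> ?F" if "p \<in> P" for p
  proof
    assume p: "p \<in> ?F"
    then have "infdist q (f ` ?F) \<le> dist q (f p)" by (simp add: infdist_le)
    moreover have "dist (g p) (f p) < \<delta> / 2" using g(2) p FB by blast
    ultimately show False using that \<delta> unfolding P_def \<delta>_def by auto
  qed
  have cF\<psi>: "compact (\<psi> ` frontier D)" by (rule compact_image_frontier[OF D(2) \<psi>D])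
  have "\<exists>r. r > 0 \<and> (\<forall>p\<in>P. r \<le> infdist p (\<psi> ` frontier D))"
  proof -
    have pos: "0 < infdist p (\<psi> ` frontier D)" if "p \<in> P" for p
      using infdist_frontier_pos[OF D(2) \<psi>D _ False] PF[OF that] \<psi>(2) by blast
    \<comment> \<open>Inserting 1 keeps the minimum meaningful when \<open>P\<close> is
      empty.\<close>
    show ?thesis
    proof (intro exI[of _ "Min (insert 1 ((\<lambda>p. infdist p (\<psi> ` frontier D)) ` P))"] conjI ballI)
      show "0 < Min (insert 1 ((\<lambda>p. infdist p (\<psi> ` frontier D)) ` P))" using \<open>finite P\<close> pos by auto
    qed (use \<open>finite P\<close> in \<open>auto intro!: Min_le\<close>)
  qed
  then obtain r1 where r1: "r1 > 0" "\<And>p. p \<in> P \<Longrightarrow> r1 \<le> infdist p (\<psi> ` frontier D)" by blast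
  have "uniformly_continuous_on ?B f" by (intro compact_uniformly_continuous continuous_on_subset[OF f] compact_cball) simp
  then obtain r2 where r2: "r2 > 0" "\<And>x x'. x \<in> ?B \<Longrightarrow> x' \<in> ?B \<Longrightarrow> dist x' x < r2 \<Longrightarrow> dist (f x') (f x) < \<delta> / 2"
    using half_gt_zero[OF \<delta>] unfolding uniformly_continuous_on_def by meson
  \<comment> \<open>The bound 1 keeps \<open>h\<close> in the ball, \<open>r1\<close> makes
    \<open>h\<close> an approximant of \<open>\<psi>\<close> at every point of \<open>P\<close>, and
    \<open>r2\<close> comes from the uniform continuity of \<open>f\<close>.\<close>
  define r where "r = min 1 (min r1 r2)"
  have r: "r > 0" using r1 r2 by (simp add: r_def)
  obtain h where h: "C1_map_on UNIV h" "\<And>x. x \<in> closure D \<Longrightarrow> dist (h x) (\<psi> x) < r" "\<And>p. p \<in> P \<Longrightarrow> regular_value_on UNIV h p"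
    using approximation_with_regular_values[of "closure D" \<psi> P r thesis] \<psi>D D(2) \<open>finite P\<close> r by (auto simp: compact_closure)
  have hc: "continuous_on S h" for S using C1_map_on_continuous_on[OF h(1)] continuous_on_subset by blast
  have hB: "h x \<in> ?B" "\<psi> x \<in> ?B" if "x \<in> closure D" for x
  proof -
    have "norm (\<psi> x) \<le> R" using R that by blast
    moreover have "dist (h x) (\<psi> x) < 1" using h(2)[OF that] by (simp add: r_def)
    ultimately show "h x \<in> ?B" "\<psi> x \<in> ?B" using norm_triangle_ineq[of "\<psi> x" "h x - \<psi> x"] by (auto simp: dist_norm)
  qed
  have happ: "degree_approximant \<psi> D p h" if "p \<in> P" for p
    unfolding degree_approximant_def
  proof (intro conjI ballI)
    show "continuous_on (closure D) h" by (rule hc)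
    show "C1_map_on D h" by (rule C1_map_on_subset[OF h(1)]) simp
    show "regular_value_on D h p" using h(3)[OF that] by (simp add: regular_value_on_def)
    show "dist (h x) (\<psi> x) < infdist p (\<psi> ` frontier D)" if "x \<in> closure D" for x
      using h(2)[OF that] r1(2)[OF \<open>p \<in> P\<close>] by (simp add: r_def)
  qed
  \<comment> \<open>Since \<open>\<psi>\<close> maps \<open>frontier D\<close> into
    \<open>frontier W\<close>, its degree is constant on the connected set \<open>W\<close>, and
    also on the exterior of \<open>W\<close>, where it is 0.\<close>
  have dh: "regular_degree h D p = (if p \<in> W then of_int (brouwer_deg \<psi> D p0) else 0)" if p: "p \<in> P" for p
  proof -
    have eq: "regular_degree h D p = of_int (brouwer_deg \<psi> D p)"
      using brouwer_deg_eq_regular_degree[OF D happ[OF p]] by simp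
    show ?thesis
    proof (cases "p \<in> W")
      case True
      have "W \<inter> \<psi> ` frontier D = {}" using \<psi>(2) W(1) by (auto simp: frontier_def interior_open)
      then have "brouwer_deg \<psi> D p = brouwer_deg \<psi> D p0"
        by (rule brouwer_deg_connected_const[OF D \<psi>D W(3) _ True W(5)])
      then show ?thesis using True eq by simp
    next
      case False
      have pc: "p \<in> - closure W" using False PF[OF p] by (simp add: frontier_def interior_open W(1))
      have "- closure W \<inter> \<psi> ` frontier D = {}" using \<psi>(2) by (auto simp: frontier_def)
      moreover have "\<not> bounded (- closure W)" using cobounded_imp_unbounded[of "- closure W"] bounded_closure[OF W(2)] by simp
      ultimately have "brouwer_deg \<psi> D p = 0"
        using brouwer_deg_eq_0_unbounded[OF D \<psi>D W(4) _ _ pc] by blast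
      then show ?thesis using False eq by simp
    qed
  qed
  define J where "J = (\<lambda>x. jacobian g (at x))"
  define H where "H = (\<lambda>x. jacobian h (at x))"
  have gJ: "C1_with UNIV g J" and hH: "C1_with UNIV h H" using g(1) h(1) by (auto simp: C1_map_on_with J_def H_def)
  have comp: "C1_with UNIV (\<lambda>x. g (h x)) (\<lambda>x. J (h x) ** H x)"
    by (rule C1_with_compose[OF hH gJ]) simp
  have jc: "jacobian (\<lambda>x. g (h x)) (at x) = J (h x) ** H x" for x
    using C1_with_jacobian[OF comp] by simp
  have nzJ: "det (J p) \<noteq> 0" if "p \<in> P" for p using gq that by (auto simp: regular_value_on_def P_def J_def)
  have nzH: "det (H x) \<noteq> 0" if "h x \<in> P" for x using h(3)[OF that] by (auto simp: regular_value_on_def H_def)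
  have pre: "x \<in> D \<and> g (h x) = q \<longleftrightarrow> x \<in> D \<and> h x \<in> P" for x
    using hB(1)[of x] closure_subset[of D] by (auto simp: P_def)
  have app: "degree_approximant (\<lambda>x. f (\<psi> x)) D q (\<lambda>x. g (h x))"
    unfolding degree_approximant_def
  proof (intro conjI ballI)
    show "continuous_on (closure D) (\<lambda>x. g (h x))" using C1_with_continuous_on[OF comp] continuous_on_subset by blast
    show "C1_map_on D (\<lambda>x. g (h x))" by (rule C1_map_on_subset[OF C1_with_imp[OF comp]]) simp
    show "regular_value_on D (\<lambda>x. g (h x)) q"
      unfolding regular_value_on_def
    proof (intro ballI impI)
      fix x assume "x \<in> D" "g (h x) = q"
      then have "h x \<in> P" using pre by blast
      then show "det (jacobian (\<lambda>x. g (h x)) (at x)) \<noteq> 0" using nzJ nzH by (simp add: jc det_mul)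
    qed
    fix x assume x: "x \<in> closure D"
    have "dist (g (h x)) (f (h x)) < \<delta> / 2" using g(2) hB(1)[OF x] by blast
    moreover have "dist (f (h x)) (f (\<psi> x)) < \<delta> / 2"
      using r2(2)[OF hB(2,1)[OF x]] h(2)[OF x] by (simp add: r_def)
    ultimately have "dist (g (h x)) (f (\<psi> x)) < \<delta>" using dist_triangle[of "g (h x)" "f (\<psi> x)" "f (h x)"] by linarith
    then show "dist (g (h x)) (f (\<psi> x)) < infdist q ((\<lambda>x. f (\<psi> x)) ` frontier D)" by (simp add: \<delta>_def)
  qed
  have appg: "degree_approximant f W q g"
    unfolding degree_approximant_def
  proof (intro conjI ballI)
    show "continuous_on (closure W) g" by (rule gc)
    show "C1_map_on W g" by (rule C1_map_on_subset[OF g(1)]) simp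
    show "regular_value_on W g q" using gq by (simp add: regular_value_on_def)
    show "dist (g x) (f x) < infdist q (f ` ?F)" if "x \<in> closure W" for x
    proof -
      have "dist (g x) (f x) < \<delta> / 2" using g(2) WB that by blast
      then show ?thesis using \<delta> by (simp add: \<delta>_def)
    qed
  qed
  have finp: "finite {x \<in> D. h x = p}" if "p \<in> P" for p
  proof (rule finite_regular_preimage[OF D hc])
    show "C1_map_on D h" "regular_value_on D h p" using happ[OF that] by (auto simp: degree_approximant_def)
    show "p \<notin> h ` frontier D"
    proof
      assume "p \<in> h ` frontier D"
      then obtain x where x: "x \<in> frontier D" "p = h x" by blast
      then have "dist (h x) (\<psi> x) < infdist p (\<psi> ` frontier D)"
        using happ[OF that] by (auto simp: degree_approximant_def frontier_def)
      moreover have "infdist p (\<psi> ` frontier D) \<le> dist p (\<psi> x)" using x(1) by (simp add: infdist_le)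
      ultimately show False using x(2) by simp
    qed
  qed
  \<comment> \<open>The chain rule factors each sign. Grouping the preimages by
    \<open>p = h x\<close> makes the inner sum the regular degree of \<open>h\<close> at
    \<open>p\<close>.\<close>
  have "regular_degree (\<lambda>x. g (h x)) D q = (\<Sum>x | x \<in> D \<and> h x \<in> P. sgn (det (J (h x))) * sgn (det (H x)))"
    unfolding regular_degree_def pre by (simp add: jc det_mul sgn_mult)
  also have "\<dots> = (\<Sum>p\<in>P. \<Sum>x\<in>{x. x \<in> {x. x \<in> D \<and> h x \<in> P} \<and> h x = p}. sgn (det (J (h x))) * sgn (det (H x)))"
  proof (rule sum.group[symmetric])
    have "{x. x \<in> D \<and> h x \<in> P} = (\<Union>p\<in>P. {x \<in> D. h x = p})" by auto
    then show "finite {x. x \<in> D \<and> h x \<in> P}" using \<open>finite P\<close> finp by simp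
  qed (use \<open>finite P\<close> in auto)
  also have "\<dots> = (\<Sum>p\<in>P. sgn (det (J p)) * regular_degree h D p)"
  proof (rule sum.cong[OF refl])
    fix p assume p: "p \<in> P"
    then have "{x. x \<in> {x. x \<in> D \<and> h x \<in> P} \<and> h x = p} = {x. x \<in> D \<and> h x = p}" by auto
    then show "(\<Sum>x\<in>{x. x \<in> {x. x \<in> D \<and> h x \<in> P} \<and> h x = p}. sgn (det (J (h x))) * sgn (det (H x))) = sgn (det (J p)) * regular_degree h D p"
      unfolding regular_degree_def H_def by (simp add: sum_distrib_left)
  qed
  also have "\<dots> = (\<Sum>p\<in>P. if p \<in> W then sgn (det (J p)) * of_int (brouwer_deg \<psi> D p0) else 0)"
    by (rule sum.cong) (auto simp: dh)
  also have "\<dots> = (\<Sum>p\<in>{p \<in> P. p \<in> W}. sgn (det (J p)) * of_int (brouwer_deg \<psi> D p0))"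
    using \<open>finite P\<close> by (rule sum.inter_filter[symmetric])
  also have "{p \<in> P. p \<in> W} = {x. x \<in> W \<and> g x = q}" using WB closure_subset[of W] by (auto simp: P_def)
  also have "(\<Sum>p\<in>{x. x \<in> W \<and> g x = q}. sgn (det (J p)) * of_int (brouwer_deg \<psi> D p0)) = of_int (brouwer_deg \<psi> D p0) * regular_degree g W q"
    unfolding regular_degree_def J_def by (simp add: sum_distrib_left mult.commute)
  finally have "real_of_int (brouwer_deg (\<lambda>x. f (\<psi> x)) D q) = real_of_int (brouwer_deg \<psi> D p0 * brouwer_deg f W q)"
    using brouwer_deg_eq_regular_degree[OF D app] brouwer_deg_eq_regular_degree[OF W(1,2) appg] by simp
  then show ?thesis by (simp only: of_int_eq_iff)
qed

subsection \<open>Injective boundary values\<close>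

text \<open>The product formula at \<open>q\<close> exhibits the degree of \<open>f\<close> as a
  divisor of 1. Its cofactor, the degree of \<open>\<psi>\<close> on \<open>D\<close>, does not
  depend on the point, so it forces the same value at \<open>q'\<close>.\<close>

lemma brouwer_deg_injective_on_frontier:
  fixes f :: "real^'n \<Rightarrow> real^'n"
  assumes W: "open W" "bounded W" "connected W" "connected (- closure W)"
    and f: "continuous_on UNIV f" "inj_on f (frontier W)"
    and q: "q \<notin> f ` frontier W" "brouwer_deg f W q \<noteq> 0"
    and q': "q' \<notin> f ` frontier W" "brouwer_deg f W q' \<noteq> 0"
  shows "brouwer_deg f W q \<in> {1, -1}" "brouwer_deg f W q' = brouwer_deg f W q"
proof -
  let ?K = "frontier W" and ?L = "f ` frontier W"
  have fW: "continuous_on (closure W) f" using f(1) continuous_on_subset by blast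
  have K: "compact ?K" by (rule compact_frontier_bounded[OF W(2)])
  have L: "compact ?L" by (rule compact_image_frontier[OF W(2) fW])
  have "W \<noteq> {}"
  proof
    assume "W = {}"
    then have "q \<notin> f ` closure W" by simp
    then show False using q(2) brouwer_deg_eq_0_outside_image[OF W(1,2) fW] by blast
  qed
  then obtain p0 where p0: "p0 \<in> W" by blast
  have "continuous_on ?L (inv_into ?K f)"
    by (rule continuous_on_inv[OF continuous_on_subset[OF f(1)] K]) (use f(2) in auto)
  moreover have "closedin (top_of_set UNIV) ?L" using compact_imp_closed[OF L] by simp
  ultimately obtain \<psi> where \<psi>: "continuous_on UNIV \<psi>" "\<And>x. x \<in> ?L \<Longrightarrow> \<psi> x = inv_into ?K f x"
    using Tietze_unbounded by blast
  have f\<psi>: "f (\<psi> x) = x" "\<psi> x \<in> ?K" if "x \<in> ?L" for x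
    using \<psi>(2)[OF that] f_inv_into_f[OF that] inv_into_into[OF that] by simp_all
  define D where "D = connected_component_set (- ?L) q"
  have oL: "open (- ?L)" by (rule open_Compl[OF compact_imp_closed[OF L]])
  have qL: "q \<in> - ?L" using q(1) by blast
  have "open D" unfolding D_def by (rule open_connected_component[OF oL])
  moreover have "connected D" unfolding D_def by (rule connected_connected_component)
  moreover have "q \<in> D" unfolding D_def using connected_component_refl[OF qL] by (rule CollectI)
  moreover have "D \<subseteq> - ?L" unfolding D_def by (rule connected_component_subset)
  ultimately have D: "open D" "connected D" "q \<in> D" "D \<subseteq> - ?L" .
  have Dfr: "frontier D \<subseteq> ?L"
    using frontier_of_components_closed_complement[OF compact_imp_closed[OF L], of D] qL
    by (simp add: D_def components_def)
  \<comment> \<open>An unbounded component would force degree 0 at \<open>q\<close>.\<close>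
  have Db: "bounded D"
  proof (rule ccontr)
    assume "\<not> bounded D"
    moreover have "D \<inter> ?L = {}" using D(4) by blast
    ultimately have "brouwer_deg f W q = 0" using brouwer_deg_eq_0_unbounded[OF W(1,2) fW D(2) _ _ D(3)] by blast
    then show False using q(2) by simp
  qed
  have prod: "brouwer_deg \<psi> D p0 * brouwer_deg f W u = (if u \<in> D then 1 else 0)" if u: "u \<notin> ?L" for u
  proof -
    have uD: "u \<notin> frontier D" using Dfr u by blast
    have fp: "continuous_on (closure D) (\<lambda>x. f (\<psi> x))"
      using continuous_on_compose2[OF f(1) \<psi>(1)] continuous_on_subset by blast
    have "brouwer_deg \<psi> D p0 * brouwer_deg f W u = brouwer_deg (\<lambda>x. f (\<psi> x)) D u"
      by (rule brouwer_deg_compose[OF W p0 D(1) Db f(1) \<psi>(1) _ u, symmetric]) (use Dfr f\<psi>(2) in blast)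
    \<comment> \<open>As \<open>frontier D\<close> lies in the image of \<open>frontier W\<close>,
      the composed map is the identity there, and the degree depends on boundary values
      alone.\<close>
    also have "\<dots> = brouwer_deg (\<lambda>x. x) D u"
    proof (rule brouwer_deg_boundary_cong[OF D(1) Db fp continuous_on_id])
      show "f (\<psi> x) = x" if "x \<in> frontier D" for x using that Dfr f\<psi>(1) by blast
      then show "u \<notin> (\<lambda>x. f (\<psi> x)) ` frontier D" using uD by auto
    qed
    also have "\<dots> = (if u \<in> D then 1 else 0)" by (rule brouwer_deg_id[OF D(1) Db uD])
    finally show ?thesis .
  qed
  have 1: "brouwer_deg \<psi> D p0 * brouwer_deg f W q = 1" using prod[OF q(1)] D(3) by simp
  then show "brouwer_deg f W q \<in> {1, -1}" by (auto simp: zmult_eq_1_iff)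
  have nz: "brouwer_deg \<psi> D p0 \<noteq> 0" using 1 by auto
  then have "brouwer_deg \<psi> D p0 * brouwer_deg f W q' \<noteq> 0" using q'(2) by simp
  \<comment> \<open>A nonzero product must be the value 1, so \<open>q'\<close> lies in
    \<open>D\<close> too and the common factor can be cancelled.\<close>
  then have "brouwer_deg \<psi> D p0 * brouwer_deg f W q' = brouwer_deg \<psi> D p0 * brouwer_deg f W q"
    using prod[OF q'(1)] 1 by (simp split: if_splits)
  then show "brouwer_deg f W q' = brouwer_deg f W q" using nz by simp
qed

text \<open>Every connected subset of \<open>- frontier W\<close> lies in \<open>W\<close> or in
  \<open>- closure W\<close>. Hence \<open>W\<close> is one of the two components, and the other one
  fills the exterior.\<close>

lemma connected_exterior:
  fixes W :: "'a::euclidean_space set"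
  assumes "open W" "connected W" "card (components (- frontier W)) = 2"
  shows "connected (- closure W)"
proof -
  have eq: "- frontier W = W \<union> - closure W"
    using closure_subset[of W] by (auto simp: frontier_def interior_open[OF assms(1)])
  have disj: "W \<inter> - closure W = {}" using closure_subset[of W] by auto
  have sub: "C \<subseteq> W \<or> C \<subseteq> - closure W" if "connected C" "C \<subseteq> - frontier W" for C
    using connectedD[OF that(1) assms(1), of "- closure W"] that(2) disj unfolding eq by auto
  have "W \<noteq> {}"
  proof
    assume "W = {}"
    then have "components (- frontier W) = {UNIV}" by (simp add: components_eq_sing_iff)
    then show False using assms(3) by simp
  qed
  have "W \<in> components (- frontier W)"
    unfolding in_components_maximal
  proof (intro conjI allI impI)
    show "W \<subseteq> - frontier W" using eq by blast
    show "C = W" if "C \<noteq> {} \<and> W \<subseteq> C \<and> C \<subseteq> - frontier W \<and> connected C" for C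
      using sub[of C] that \<open>W \<noteq> {}\<close> disj by blast
  qed (use assms(2) \<open>W \<noteq> {}\<close> in auto)
  moreover obtain C1 C2 where C: "components (- frontier W) = {C1, C2}" "C1 \<noteq> C2"
    using assms(3) by (auto simp: card_2_iff)
  ultimately have "W = C1 \<or> W = C2" by simp
  then have "\<exists>C. components (- frontier W) = {W, C} \<and> C \<noteq> W"
  proof
    assume "W = C1"
    then show ?thesis using C by (intro exI[of _ C2]) simp
  next
    assume "W = C2"
    then show ?thesis using C by (intro exI[of _ C1]) (simp add: insert_commute)
  qed
  then obtain C where C: "components (- frontier W) = {W, C}" "C \<noteq> W" by (elim exE conjE)
  have Cc: "C \<in> components (- frontier W)" using C(1) by blast
  have "W \<inter> C = {}" using components_nonoverlap[OF \<open>W \<in> components (- frontier W)\<close> Cc] C(2) by blast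
  moreover have "C \<noteq> {}" using in_components_nonempty[OF Cc] .
  ultimately have "C \<subseteq> - closure W"
    using sub[OF in_components_connected[OF Cc] in_components_subset[OF Cc]] by blast
  moreover have "- frontier W = \<Union> {W, C}" using Union_components[of "- frontier W"] unfolding C(1) by (rule sym)
  then have "W \<union> C = W \<union> - closure W" unfolding eq by simp
  ultimately have "C = - closure W" using disj by blast
  then show ?thesis using in_components_connected[OF Cc] by simp
qed

section \<open>Degree values of maps approximately invertible on the boundary\<close>

theorem theorem22:
  fixes \<Omega> :: "(real^'n) set" and y :: "real^'n \<Rightarrow> real^'n"
  assumes "CARD('n) \<ge> 2"
    and "bounded \<Omega>" and "open \<Omega>" and "connected \<Omega>"
    and "card (components (- frontier \<Omega>)) = 2"
    and "continuous_on (closure \<Omega>) y"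
    and "AIB \<Omega> y"
  shows "(\<exists>\<sigma>\<in>{1, -1}. \<forall>z\<in>im_T y \<Omega>. brouwer_deg y \<Omega> z = \<sigma>) \<and>
    open (im_T y \<Omega>) \<and>
    im_T y \<Omega> \<subseteq> bounded_part (- (y ` frontier \<Omega>)) \<and>
    (\<forall>C \<in> components (bounded_part (- (y ` frontier \<Omega>))).
       C \<subseteq> im_T y \<Omega> \<or> C \<inter> im_T y \<Omega> = {})"
proof -
  note \<Omega> = assms(3,2) and y = assms(6)
  let ?K = "frontier \<Omega>"
  have ext: "connected (- closure \<Omega>)" by (rule connected_exterior[OF assms(3,4,5)])
  have K: "compact ?K" by (rule compact_frontier_bounded[OF assms(2)])
  have sub: "?K \<subseteq> closure \<Omega>" by (simp add: frontier_def)
  obtain \<phi> :: "nat \<Rightarrow> real^'n \<Rightarrow> real^'n" where \<phi>: "\<And>k. continuous_on ?K (\<phi> k)" "\<And>k. inj_on (\<phi> k) ?K"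
    "uniform_limit ?K \<phi> y sequentially"
    using assms(7) unfolding AIB_def by blast
  have two: "brouwer_deg y \<Omega> z \<in> {1, -1} \<and> brouwer_deg y \<Omega> z' = brouwer_deg y \<Omega> z"
    if z: "z \<in> im_T y \<Omega>" and z': "z' \<in> im_T y \<Omega>" for z z'
  proof -
    have cl: "closed (y ` ?K)" by (rule compact_imp_closed[OF compact_image_frontier[OF assms(2) y]])
    have zK: "z \<notin> y ` ?K" "z' \<notin> y ` ?K" using z z' by (simp_all add: im_T_def)
    obtain d where d: "d > 0" "\<forall>w\<in>y ` ?K. d \<le> dist z w" using separate_point_closed[OF cl zK(1)] by blast
    obtain d' where d': "d' > 0" "\<forall>w\<in>y ` ?K. d' \<le> dist z' w" using separate_point_closed[OF cl zK(2)] by blast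
    have "\<forall>\<^sub>F k in sequentially. \<forall>x\<in>?K. dist (\<phi> k x) (y x) < min d d'"
      using \<phi>(3) d(1) d'(1) by (intro uniform_limitD) auto
    then obtain k where k: "\<And>x. x \<in> ?K \<Longrightarrow> dist (\<phi> k x) (y x) < min d d'"
      unfolding eventually_sequentially by blast
    have "closedin (top_of_set UNIV) ?K" using compact_imp_closed[OF K] by simp
    \<comment> \<open>\<open>\<phi> k\<close> lives on the frontier only. Any continuous extension
      will do, because the degree is determined by boundary values.\<close>
    then obtain f where f: "continuous_on UNIV f" "\<And>x. x \<in> ?K \<Longrightarrow> f x = \<phi> k x"
      using Tietze_unbounded[OF \<phi>(1)[of k]] by blast
    have inj: "inj_on f ?K" using \<phi>(2)[of k] f(2) inj_on_cong by blast
    have fc: "continuous_on (closure \<Omega>) f" using f(1) continuous_on_subset by blast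
    have seg: "u \<notin> closed_segment (y x) (f x)"
      if u: "\<forall>w\<in>y ` ?K. r \<le> dist u w" "min d d' \<le> r" "r > 0" and x: "x \<in> ?K" for u r x
    proof -
      have "f x \<in> ball (y x) r" "y x \<in> ball (y x) r"
        using order_less_le_trans[OF k[OF x] u(2)] u(3) f(2)[OF x] by (simp_all add: dist_commute)
      then have "closed_segment (y x) (f x) \<subseteq> ball (y x) r" using closed_segment_subset_ball by blast
      moreover have "r \<le> dist u (y x)" using u(1) x by blast
      then have "u \<notin> ball (y x) r" by (simp add: dist_commute)
      ultimately show ?thesis by blast
    qed
    have eq: "brouwer_deg y \<Omega> z = brouwer_deg f \<Omega> z" "brouwer_deg y \<Omega> z' = brouwer_deg f \<Omega> z'"
      by (rule brouwer_deg_homotopy[OF \<Omega> y fc], rule seg[of d] seg[of d'], use d d' in auto)+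
    have nf: "z \<notin> f ` ?K" "z' \<notin> f ` ?K"
      using seg[of d z] seg[of d' z'] d d' ends_in_segment(2) by fastforce+
    have nz: "brouwer_deg f \<Omega> z \<noteq> 0" "brouwer_deg f \<Omega> z' \<noteq> 0"
      using z z' eq by (simp_all add: im_T_def)
    show ?thesis
      using brouwer_deg_injective_on_frontier[OF \<Omega> assms(4) ext f(1) inj nf(1) nz(1) nf(2) nz(2)] eq by simp
  qed
  have const: "C \<subseteq> im_T y \<Omega> \<or> C \<inter> im_T y \<Omega> = {}" if C: "connected C" "C \<subseteq> - (y ` ?K)" for C
  proof -
    have "b \<in> im_T y \<Omega>" if "a \<in> C" "a \<in> im_T y \<Omega>" "b \<in> C" for a b
    proof -
      have "C \<inter> y ` ?K = {}" using C(2) by blast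
      then have "brouwer_deg y \<Omega> a = brouwer_deg y \<Omega> b"
        using brouwer_deg_connected_const[OF \<Omega> y C(1)] that by blast
      then show ?thesis using that C(2) by (auto simp: im_T_def)
    qed
    then show ?thesis by blast
  qed
  have "\<exists>\<sigma>\<in>{1, -1}. \<forall>z\<in>im_T y \<Omega>. brouwer_deg y \<Omega> z = \<sigma>"
  \<comment> \<open>If the topological image is empty, either sign serves; otherwise the degree at
    any one of its points is the common value.\<close>
  proof (cases "im_T y \<Omega> = {}")
    case False
    then obtain z where "z \<in> im_T y \<Omega>" by blast
    then have "brouwer_deg y \<Omega> z \<in> {1, -1}" "\<forall>z'\<in>im_T y \<Omega>. brouwer_deg y \<Omega> z' = brouwer_deg y \<Omega> z"
      using two by blast+
    then show ?thesis by (rule bexI[rotated])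
  qed auto
  moreover have "open (im_T y \<Omega>)"
    unfolding open_dist
  proof
    fix z assume z: "z \<in> im_T y \<Omega>"
    then have "z \<notin> y ` ?K" by (simp add: im_T_def)
    then obtain r where r: "r > 0" "\<And>z'. dist z z' < r \<Longrightarrow> z' \<notin> y ` ?K \<and> brouwer_deg y \<Omega> z' = brouwer_deg y \<Omega> z"
      by (rule brouwer_deg_locally_constant[OF \<Omega> y]) (rule that; blast)
    then show "\<exists>e>0. \<forall>w. dist w z < e \<longrightarrow> w \<in> im_T y \<Omega>"
    proof (intro exI[of _ r] conjI allI impI)
      show "w \<in> im_T y \<Omega>" if "dist w z < r" for w
        using r(2)[of w] that z by (simp add: im_T_def dist_commute)
    qed (rule r(1))
  qed
  moreover have "im_T y \<Omega> \<subseteq> bounded_part (- (y ` ?K))"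
  proof
    fix z assume z: "z \<in> im_T y \<Omega>"
    let ?C = "connected_component_set (- (y ` ?K)) z"
    have zK: "z \<in> - (y ` ?K)" using z by (simp add: im_T_def)
    have zC: "z \<in> ?C" using zK by simp
    have "?C \<inter> y ` ?K = {}" using connected_component_subset by blast
    then have "bounded ?C"
      using brouwer_deg_eq_0_unbounded[OF \<Omega> y connected_connected_component _ _ zC] z
      by (auto simp: im_T_def)
    moreover have "?C \<in> components (- (y ` ?K))" using zK by (simp add: components_def)
    ultimately show "z \<in> bounded_part (- (y ` ?K))" unfolding bounded_part_def using zC by blast
  qed
  moreover have "C \<subseteq> im_T y \<Omega> \<or> C \<inter> im_T y \<Omega> = {}" if "C \<in> components (bounded_part (- (y ` ?K)))" for C
  \<comment> \<open>It suffices that \<open>C\<close> is connected and avoids the boundary image; it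
    need not be identified as a component of the full complement.\<close>
  proof (rule const[OF in_components_connected[OF that]])
    have "bounded_part (- (y ` ?K)) \<subseteq> - (y ` ?K)"
      unfolding bounded_part_def using in_components_subset by blast
    then show "C \<subseteq> - (y ` ?K)" using in_components_subset[OF that] by blast
  qed
  ultimately show ?thesis by blast
qed

end
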